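(* Let $q$ be an odd prime power. Let $\mathrm{sz}(n,k)$ be the number of invertible $n\times n$ symmetric matrices over $\mathbf{F}_q$ with the first $k$ diagonal entries equal to $0$, let $\mathrm{sz}^+(n,k)$ be the number of those whose determinant is a nonzero square in $\mathbf{F}_q$ (quadratic character $+$), and let $\mathrm{sym}(n)$ be the number of invertible $n\times n$ symmetric matrices over $\mathbf{F}_q$. Let $m\ge1$. For $0\le k\le 2m-1$, $$\mathrm{sz}(2m,k+1)=\frac{1}{q^{k+1}}\,\mathrm{sym}(2m).$$ For $0\le k\le 2m$, $$\mathrm{sz}(2m+1,k+1)=\frac{q^{m^2+m}}{q^{k+1}}\sum_{j=0}^{\lfloor k/2\rfloor+1}(-1)^j(q-1)^{m+j}[2m-2j+1]_q!!\left(\binom{k+1}{2j-1}+(q-1)\binom{k+1}{2j}\right).$$ In terms of the character: for $0\le k\le 2m-1$, $$\mathrm{sz}^+(2m,k+1)=\frac{\mathrm{sym}(2m)}{2q^{k+1}}+\frac{(-1)^tq^{m^2}}{2q^{k+1}}\sum_{j=0}^{\lceil k/2\rceil}(-1)^j(q-1)^{m+j}[2m-2j-1]_q!!\left(\binom{k+1}{2j}+(q-1)\binom{k+1}{2j+1}\right),$$ where $t=0$ if $(-1)^m$ is a square in $\mathbf{F}_q$ and $t=1$ otherwise; and for $0\le k\le 2m$, $$\mathrm{sz}^+(2m+1,k+1)=\frac12\,\mathrm{sz}(2m+1,k+1).$$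
   Context: $\mathbf{F}_q$ is the field with $q$ elements. $[n]_q=\frac{q^n-1}{q-1}$ and $[n]_q!!=[n]_q[n-2]_q[n-4]_q\cdots$ (the product over positive arguments), with $[0]_q!!=[-1]_q!!=1$. Binomial coefficients $\binom{a}{b}$ with $b<0$ or $b>a$ are zero. *)

theory Defs
  imports
    "HOL-Library.Cardinality"
    "Jordan_Normal_Form.Determinant"
    "HOL-Computational_Algebra.Nth_Powers"
begin

text \<open>The field with \<open>q\<close> elements is a type \<open>'a\<close> of sort \<open>{finite, field}\<close> with \<open>CARD('a) = q\<close>.
  Matrix indices start at 0, so the first \<open>k\<close> diagonal entries are those with index \<open>i < k\<close>;
  the definitions below are meant for \<open>k \<le> n\<close>.\<close>

definition sym_mats :: "nat \<Rightarrow> 'a::field mat set" where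
  "sym_mats n = {A \<in> carrier_mat n n. A\<^sup>T = A \<and> invertible_mat A}"

definition sz_mats :: "nat \<Rightarrow> nat \<Rightarrow> 'a::field mat set" where
  "sz_mats n k = {A \<in> sym_mats n. \<forall>i<k. A $$ (i, i) = 0}"

definition sz_plus_mats :: "nat \<Rightarrow> nat \<Rightarrow> 'a::field mat set" where
  "sz_plus_mats n k = {A \<in> sz_mats n k. det A \<noteq> 0 \<and> is_square (det A)}"

definition num_sym :: "'a::{finite,field} itself \<Rightarrow> nat \<Rightarrow> nat" where
  "num_sym TYPE('a) n = card (sym_mats n :: 'a mat set)"

definition num_sz :: "'a::{finite,field} itself \<Rightarrow> nat \<Rightarrow> nat \<Rightarrow> nat" where
  "num_sz TYPE('a) n k = card (sz_mats n k :: 'a mat set)"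

definition num_sz_plus :: "'a::{finite,field} itself \<Rightarrow> nat \<Rightarrow> nat \<Rightarrow> nat" where
  "num_sz_plus TYPE('a) n k = card (sz_plus_mats n k :: 'a mat set)"

definition q_int :: "real \<Rightarrow> int \<Rightarrow> real" where
  "q_int q n = (q powi n - 1) / (q - 1)"

text \<open>The argument is an integer because the value at \<open>-1\<close> is needed: there, as at \<open>0\<close>,
  the product is empty.\<close>

definition q_dfact :: "real \<Rightarrow> int \<Rightarrow> real" where
  "q_dfact q n = (\<Prod>i | 0 < i \<and> i \<le> n \<and> even (n - i). q_int q i)"

text \<open>The lower index is an integer so that a negative one gives \<open>0\<close>; \<open>a choose b = 0\<close> for
  \<open>b > a\<close> holds in the library already.\<close>

definition zchoose :: "nat \<Rightarrow> int \<Rightarrow> nat" where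
  "zchoose a b = (if b < 0 then 0 else a choose nat b)"

end

theory Submission
  imports Defs "HOL-Number_Theory.Residues" "Jordan_Normal_Form.Column_Operations"
begin

text \<open>
  Let \<open>f\<close> be the quadratic character \<open>\<chi>\<close> of the field or the indicator of its nonzero elements, and
  let \<open>F n k\<close> be the sum of \<open>f (det A)\<close> over all symmetric \<open>A\<close> of size \<open>n\<close>, singular ones
  included, whose first \<open>k\<close> diagonal entries vanish. Both kinds of count are read off from these two
  sums, since an invertible matrix has square determinant precisely when both characters give \<open>1\<close>.

  The sums obey a recursion because the determinant is affine in a diagonal entry. Write a symmetric
  matrix of size \<open>n + 1\<close> as a border \<open>(v, a)\<close> around a symmetric \<open>B\<close>, with \<open>a\<close> the new
  diagonal entry. If \<open>det B = 0\<close>, the determinant does not depend on \<open>a\<close>, so fixing \<open>a = 0\<close> divides the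
  contribution of \<open>B\<close> to the sum by \<open>q\<close>. If \<open>det B \<noteq> 0\<close>, then
  \<open>v = B w\<close> for a unique \<open>w\<close>, and the determinant is \<open>det B * (a - Q w)\<close> with \<open>Q w\<close> the value
  at \<open>w\<close> of the quadratic form of \<open>B\<close>. Hence \<open>F (n + 1) k - q * F (n + 1) (k + 1)\<close> is a sum over the
  invertible \<open>B\<close> that involves only how often the form of \<open>B\<close> takes each value
  (\<open>symm_sum_diag_recursion\<close>). These frequencies are classical and depend on \<open>B\<close> only through
  \<open>\<chi> (det B)\<close> (\<open>num_reps_nonsingular\<close>), so the recursion closes up: with
  \<open>S m k\<close> the number of invertible matrices of size \<open>2 m + 1\<close> whose first \<open>k\<close> diagonal entries
  vanish, and \<open>Y m k\<close> the sum of \<open>\<chi> ((-1) ^ m * det A)\<close> over those of size \<open>2 m\<close>,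

  \<^item> \<open>S m k - q * S m (k + 1) = q ^ m * (q - 1) * Y m k\<close>,
  \<^item> \<open>Y (m + 1) k - q * Y (m + 1) (k + 1) = - q ^ (m + 1) * (q - 1) * S m k\<close>,

  while for the number of invertible matrices of even size, and for the character sum of odd size, the
  left-hand side is \<open>0\<close>. This proves the first formula. The last one holds because the character sum
  \<open>F\<close> of odd size vanishes: the pivot recursion below makes \<open>F n 0 = F n 1\<close>, whereas
  \<open>F n 0 = q * F n 1\<close>.

  The start values at \<open>k = 0\<close> need no separate count. Splitting by whether the last diagonal entry is
  zero, and clearing the border with that entry when it is not, relates \<open>F (n + 1) 0\<close> to \<open>F n 0\<close>
  and \<open>F (n + 1) 1\<close> (\<open>symm_sum_pivot_recursion\<close>); together with the recursion above at \<open>k = 0\<close> this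
  eliminates \<open>F (n + 1) 1\<close>. Finally, after scaling by powers of \<open>q\<close>, the recursions
  for \<open>S\<close> and \<open>Y\<close> become Pascal's rule for the binomial coefficients in the two closed
  formulas (\<open>solve_recursions\<close>).
\<close>

section \<open>The quadratic character of a finite field of odd order\<close>

text \<open>Real-valued, because its sums are mixed with powers of \<open>q\<close> and divided by them.\<close>

definition quad_char :: "'a::field \<Rightarrow> real" where
  "quad_char c = (if c = 0 then 0 else if is_square c then 1 else - 1)"

lemma quad_char_0 [simp]: "quad_char 0 = 0"
  and quad_char_eq_0_iff [simp]: "quad_char c = 0 \<longleftrightarrow> c = 0"
  by (auto simp: quad_char_def)

lemma quad_char_square [simp]: "c \<noteq> 0 \<Longrightarrow> quad_char (c\<^sup>2) = 1"
  by (auto simp: quad_char_def)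

lemma quad_char_1 [simp]: "quad_char 1 = 1"
  by (auto simp: quad_char_def)

text \<open>The characteristic divides the order of the field, so it is odd.\<close>

lemma two_neq_zero:
  assumes "odd CARD('a::{finite,field})"
  shows "(2 :: 'a) \<noteq> 0"
proof
  assume "(2 :: 'a) = 0"
  then have "of_nat 2 = (0 :: 'a)" by simp
  then have "CHAR('a) dvd 2" by (simp only: of_nat_eq_0_iff_char_dvd)
  moreover have "CHAR('a) \<noteq> 1" by simp
  ultimately have "CHAR('a) = 2" using prime_nat_iff two_is_prime_nat by blast
  then show False using CHAR_dvd_CARD[where 'a = 'a] assms by simp
qed

lemma card_square_roots:
  assumes "odd CARD('a::{finite,field})"
  shows "real (card {x :: 'a. x\<^sup>2 = c}) = 1 + quad_char c"
proof (cases "is_square c \<and> c \<noteq> 0")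
  case True
  then obtain r where r: "c = r\<^sup>2" by (auto simp: is_nth_power_def)
  have "{x. x\<^sup>2 = c} = {r, - r}" by (auto simp: r power2_eq_iff)
  moreover have "r \<noteq> - r"
  proof
    assume "r = - r"
    then have "2 * r = 0" by simp
    with two_neq_zero[OF assms] have "r = 0" by simp
    with True r show False by simp
  qed
  ultimately show ?thesis using True by (simp add: quad_char_def)
next
  case False
  then have "{x. x\<^sup>2 = c} = (if c = 0 then {0} else {})"
    by (auto simp: is_nth_power_def)
  then show ?thesis using False by (auto simp: quad_char_def)
qed

lemma sum_quad_char:
  assumes "odd CARD('a::{finite,field})"
  shows "(\<Sum>c\<in>UNIV. quad_char (c :: 'a)) = 0"
proof -
  have "(\<Sum>c\<in>UNIV. \<Sum>x\<in>{x :: 'a. x\<^sup>2 = c}. 1 :: real) = (\<Sum>x\<in>(UNIV :: 'a set). 1)"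
    using sum.group[of "UNIV :: 'a set" "UNIV :: 'a set" "\<lambda>x. x\<^sup>2" "\<lambda>_. 1 :: real"] by simp
  then have "(\<Sum>c\<in>UNIV. 1 + quad_char (c :: 'a)) = real CARD('a)"
    using card_square_roots[OF assms] by simp
  then show ?thesis by (simp add: sum.distrib)
qed

lemma sum_mult_reindex:
  fixes g :: "'a::{finite,field} \<Rightarrow> 'b::comm_monoid_add"
  assumes "a \<noteq> 0"
  shows "(\<Sum>c\<in>UNIV. g (a * c)) = (\<Sum>c\<in>UNIV. g c)"
  by (rule sum.reindex_bij_witness[of _ "\<lambda>c. c / a" "\<lambda>c. a * c"]) (use assms in auto)

lemma sum_shift_reindex:
  fixes g :: "'a::{finite,field} \<Rightarrow> 'b::comm_monoid_add"
  shows "(\<Sum>c\<in>UNIV. g (c + a)) = (\<Sum>c\<in>UNIV. g c)"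
  by (rule sum.reindex_bij_witness[of _ "\<lambda>c. c - a" "\<lambda>c. c + a"]) auto

lemma sum_affine_reindex:
  fixes g :: "'a::{finite,field} \<Rightarrow> 'b::comm_monoid_add"
  assumes "a \<noteq> 0"
  shows "(\<Sum>c\<in>UNIV. g (a * c + b)) = (\<Sum>c\<in>UNIV. g c)"
  using sum_mult_reindex[OF assms, of "\<lambda>c. g (c + b)"] sum_shift_reindex[of g b] by simp

lemma quad_char_mult_square:
  assumes "r \<noteq> 0"
  shows "quad_char (r\<^sup>2 * c) = quad_char c"
proof -
  have "is_square (r\<^sup>2 * c) \<longleftrightarrow> is_square c"
  proof
    assume "is_square (r\<^sup>2 * c)"
    then obtain s where "r\<^sup>2 * c = s\<^sup>2" by (auto simp: is_nth_power_def)
    then have "c = (s / r)\<^sup>2" using assms by (simp add: field_simps power_divide)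
    then show "is_square c" by simp
  qed (simp add: is_nth_power_mult)
  then show ?thesis using assms by (simp add: quad_char_def)
qed

text \<open>Only the product of two non-squares needs an argument. For a non-square \<open>a\<close>, the sum of
  \<open>\<chi> (a c) + \<chi> c\<close> over all \<open>c\<close> vanishes and no term is positive, so every term vanishes.\<close>

lemma quad_char_mult:
  assumes odd: "odd CARD('a::{finite,field})"
  shows "quad_char ((a :: 'a) * b) = quad_char a * quad_char b"
proof (cases "a = 0 \<or> b = 0")
  case True
  then show ?thesis by auto
next
  case nz: False
  consider "is_square a" | "is_square b" | "\<not> is_square a" "\<not> is_square b" by blast
  then show ?thesis
  proof cases
    case 1
    then obtain r where "a = r\<^sup>2" by (auto simp: is_nth_power_def)
    then show ?thesis using nz quad_char_mult_square[of r b] by simp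
  next
    case 2
    then obtain r where "b = r\<^sup>2" by (auto simp: is_nth_power_def)
    then show ?thesis using nz quad_char_mult_square[of r a] by (simp add: mult.commute)
  next
    case 3
    have le: "- quad_char (a * c) - quad_char c \<ge> 0" for c
    proof (cases "is_square c \<and> c \<noteq> 0")
      case True
      then obtain r where r: "c = r\<^sup>2" by (auto simp: is_nth_power_def)
      then show ?thesis
        using True quad_char_mult_square[of r a] 3 nz by (simp add: mult.commute quad_char_def)
    qed (auto simp: quad_char_def)
    have "(\<Sum>c\<in>UNIV. - quad_char (a * c) - quad_char c) = 0"
      using sum_mult_reindex[of a quad_char] nz sum_quad_char[OF odd]
      by (simp add: sum_subtractf sum_negf)
    then have "- quad_char (a * b) - quad_char b = 0"
      using le by (subst (asm) sum_nonneg_eq_0_iff) auto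
    then show ?thesis using 3 nz by (simp add: quad_char_def)
  qed
qed

text \<open>The number of points of a hyperbola, or of a pair of crossing lines when \<open>c = 0\<close>.\<close>

lemma card_product_eq:
  fixes c :: "'a::{finite,field}"
  shows "real (card {p :: 'a \<times> 'a. fst p * snd p = c})
           = real CARD('a) - 1 + (if c = 0 then real CARD('a) else 0)"
proof -
  have "{p :: 'a \<times> 'a. fst p * snd p = c} = Sigma UNIV (\<lambda>u. {v. u * v = c})" by auto
  then have "real (card {p :: 'a \<times> 'a. fst p * snd p = c}) = (\<Sum>u\<in>UNIV. real (card {v :: 'a. u * v = c}))"
    by simp
  also have "\<dots> = real (card {v. 0 * v = c}) + (\<Sum>u\<in>UNIV - {0}. real (card {v :: 'a. u * v = c}))"
    by (subst sum.remove[of _ 0]) auto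
  also have "(\<Sum>u\<in>UNIV - {0}. real (card {v :: 'a. u * v = c})) = (\<Sum>u\<in>UNIV - {0 :: 'a}. 1)"
  proof (rule sum.cong[OF refl])
    fix u :: 'a assume "u \<in> UNIV - {0}"
    then have "{v. u * v = c} = {c / u}" by (auto simp: field_simps)
    then show "real (card {v :: 'a. u * v = c}) = 1" by simp
  qed
  also have "\<dots> = real CARD('a) - 1"
    by (simp add: card_Diff_subset of_nat_diff Suc_leI)
  finally show ?thesis by auto
qed

text \<open>Up to the term \<open>q\<close>, the sum counts the solutions of \<open>x\<^sup>2 = y\<^sup>2 + c\<close>, and the substitution
  \<open>u = x - y\<close>, \<open>v = x + y\<close> turns this equation into \<open>u v = c\<close>.\<close>

lemma sum_quad_char_square_plus:
  assumes odd: "odd CARD('a::{finite,field})"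
  shows "(\<Sum>y\<in>UNIV. quad_char (y\<^sup>2 + c :: 'a)) = (if c = 0 then real CARD('a) else 0) - 1"
proof -
  note two = two_neq_zero[OF odd]
  have four: "(4 :: 'a) \<noteq> 0" using two mult_eq_0_iff[of "2::'a" 2] by simp
  have "(\<Sum>y\<in>UNIV. 1 + quad_char (y\<^sup>2 + c :: 'a)) = (\<Sum>y\<in>UNIV. real (card {x. x\<^sup>2 = y\<^sup>2 + c}))"
    by (simp add: card_square_roots[OF odd])
  also have "\<dots> = real (card (Sigma UNIV (\<lambda>y :: 'a. {x. x\<^sup>2 = y\<^sup>2 + c})))" by simp
  also have "card (Sigma UNIV (\<lambda>y :: 'a. {x. x\<^sup>2 = y\<^sup>2 + c})) = card {p :: 'a \<times> 'a. fst p * snd p = c}"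
  proof (rule bij_betw_same_card[where f = "\<lambda>(y, x). (x - y, x + y)"],
         rule bij_betw_byWitness[where f' = "\<lambda>(u, v). ((v - u) / 2, (u + v) / 2)"])
    show "(\<lambda>(u, v). ((v - u) / 2, (u + v) / 2)) ` {p :: 'a \<times> 'a. fst p * snd p = c}
            \<subseteq> Sigma UNIV (\<lambda>y. {x. x\<^sup>2 = y\<^sup>2 + c})"
    proof clarsimp
      fix u v :: 'a
      have "((u + v) / 2)\<^sup>2 = (u + v)\<^sup>2 / 4" "((v - u) / 2)\<^sup>2 = (v - u)\<^sup>2 / 4"
        by (simp_all add: power_divide)
      with four show "((u + v) / 2)\<^sup>2 = ((v - u) / 2)\<^sup>2 + u * v"
        by (simp add: divide_simps) (simp add: power2_eq_square algebra_simps)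
    qed
  qed (use two four in \<open>auto simp: field_simps power2_eq_square\<close>)
  finally show ?thesis by (simp add: card_product_eq sum.distrib)
qed

lemma sum_quad_char_quadratic:
  assumes odd: "odd CARD('a::{finite,field})" and a: "(a :: 'a) \<noteq> 0"
  shows "(\<Sum>y\<in>UNIV. quad_char (c - a * y\<^sup>2)) = quad_char (- a) * ((if c = 0 then real CARD('a) else 0) - 1)"
proof -
  have "quad_char (c - a * y\<^sup>2) = quad_char (- a) * quad_char (y\<^sup>2 + - c / a)" for y
  proof -
    have "c - a * y\<^sup>2 = - a * (y\<^sup>2 + - c / a)" using a by (simp add: algebra_simps)
    then show ?thesis by (simp only: quad_char_mult[OF odd])
  qed
  then have "(\<Sum>y\<in>UNIV. quad_char (c - a * y\<^sup>2)) = quad_char (- a) * (\<Sum>y\<in>UNIV. quad_char (y\<^sup>2 + - c / a))"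
    by (simp only: sum_distrib_left)
  then show ?thesis using a by (simp only: sum_quad_char_square_plus[OF odd]) simp
qed

lemma card_scaled_square_roots:
  assumes odd: "odd CARD('a::{finite,field})" and a: "(a :: 'a) \<noteq> 0"
  shows "real (card {y. c = a * y\<^sup>2}) = 1 + quad_char (a * c)"
proof -
  have "{y. c = a * y\<^sup>2} = {y. y\<^sup>2 = c / a}" using a by (auto simp: field_simps)
  moreover have "quad_char (a * c) = quad_char (c / a)"
    using quad_char_mult_square[of a "c / a"] a by (simp add: power2_eq_square)
  ultimately show ?thesis by (simp add: card_square_roots[OF odd])
qed

section \<open>Bordered matrices and quadratic forms\<close>

text \<open>The border is the last row and column; the size is that of \<open>v\<close>.\<close>

definition border :: "'a mat \<Rightarrow> 'a vec \<Rightarrow> 'a \<Rightarrow> 'a mat" where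
  "border B v a = mat (Suc (dim_vec v)) (Suc (dim_vec v)) (\<lambda>(i, j).
     if i < dim_vec v then (if j < dim_vec v then B $$ (i, j) else v $ i)
     else if j < dim_vec v then v $ j else a)"

lemma border_carrier [simp]: "v \<in> carrier_vec n \<Longrightarrow> border B v a \<in> carrier_mat (Suc n) (Suc n)"
  by (auto simp: border_def)

lemma border_four_block:
  assumes "B \<in> carrier_mat n n" "v \<in> carrier_vec n"
  shows "border B v a = four_block_mat B (mat n 1 (\<lambda>(i, j). v $ i)) (mat 1 n (\<lambda>(i, j). v $ j)) (mat 1 1 (\<lambda>_. a))"
  by (rule eq_matI) (use assms in \<open>auto simp: border_def\<close>)

definition quad_form :: "'a::comm_ring_1 mat \<Rightarrow> 'a vec \<Rightarrow> 'a" where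
  "quad_form A v = v \<bullet> (A *\<^sub>v v)"

lemma quad_form_sum:
  assumes "A \<in> carrier_mat n n" "v \<in> carrier_vec n"
  shows "quad_form A v = (\<Sum>i<n. \<Sum>j<n. v $ i * A $$ (i, j) * v $ j)"
  using assms
  by (simp add: quad_form_def scalar_prod_def sum_distrib_left mult.assoc lessThan_atLeast0)

text \<open>Laplace expansion along the last row: none of the cofactors involves the corner \<open>a\<close>.\<close>

lemma det_border_affine:
  fixes B :: "'a::comm_ring_1 mat"
  assumes B: "B \<in> carrier_mat n n" and v: "v \<in> carrier_vec n"
  shows "det (border B v a) = a * det B + det (border B v 0)"
proof -
  have delB: "mat_delete (border B v a) n n = B" for a
    by (rule eq_matI) (use B v in \<open>auto simp: mat_delete_def border_def\<close>)
  have det: "det (border B v a) = (\<Sum>j<n. v $ j * cofactor (border B v 0) n j) + a * det B" for a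
  proof -
    have "det (border B v a) = (\<Sum>j<Suc n. border B v a $$ (n, j) * cofactor (border B v a) n j)"
      by (rule laplace_expansion_row) (use v in auto)
    also have "\<dots> = (\<Sum>j<n. border B v a $$ (n, j) * cofactor (border B v a) n j)
        + border B v a $$ (n, n) * cofactor (border B v a) n n" by simp
    also have "border B v a $$ (n, n) * cofactor (border B v a) n n = a * det B"
      using v by (simp add: cofactor_def delB) (simp add: border_def)
    also have "(\<Sum>j<n. border B v a $$ (n, j) * cofactor (border B v a) n j)
        = (\<Sum>j<n. v $ j * cofactor (border B v 0) n j)"
    proof (rule sum.cong[OF refl])
      fix j assume "j \<in> {..<n}"
      then have j: "j < n" by simp
      have "mat_delete (border B v a) n j = mat_delete (border B v 0) n j"
        by (rule eq_matI) (use v j in \<open>auto simp: mat_delete_def border_def\<close>)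
      then show "border B v a $$ (n, j) * cofactor (border B v a) n j = v $ j * cofactor (border B v 0) n j"
        using v j by (simp add: cofactor_def) (simp add: border_def)
    qed
    finally show ?thesis .
  qed
  show ?thesis using det[of a] det[of 0] by simp
qed

text \<open>The Schur complement of the corner \<open>a\<close> in the bordered matrix \<open>border B v a\<close>.\<close>

definition schur_compl :: "'a::field mat \<Rightarrow> 'a vec \<Rightarrow> 'a \<Rightarrow> 'a mat" where
  "schur_compl B v a = mat (dim_vec v) (dim_vec v) (\<lambda>(i, j). B $$ (i, j) - v $ i * v $ j / a)"

lemma schur_compl_carrier [simp]: "v \<in> carrier_vec n \<Longrightarrow> schur_compl B v a \<in> carrier_mat n n"
  by (auto simp: schur_compl_def)

text \<open>A nonzero corner clears the border: the bordered matrix is an upper block triangular matrix with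
  diagonal blocks \<open>schur_compl B v a\<close> and \<open>a\<close>, times a unipotent one.\<close>

lemma det_border_schur:
  assumes B: "B \<in> carrier_mat n n" and v: "v \<in> carrier_vec n" and a: "a \<noteq> 0"
  shows "det (border B v a) = a * det (schur_compl B v a)"
proof -
  let ?c = "mat n 1 (\<lambda>(i, j). v $ i)" and ?r = "mat 1 n (\<lambda>(i, j). v $ j)" and ?a = "mat 1 1 (\<lambda>_. a)"
  let ?U = "four_block_mat (schur_compl B v a) ?c (0\<^sub>m 1 n) ?a"
  let ?L = "four_block_mat (1\<^sub>m n) (0\<^sub>m n 1) (mat 1 n (\<lambda>(i, j). v $ j / a)) (1\<^sub>m 1)"
  have S: "schur_compl B v a \<in> carrier_mat n n" using v by simp
  have "?U * ?L = four_block_mat (schur_compl B v a * 1\<^sub>m n + ?c * mat 1 n (\<lambda>(i, j). v $ j / a))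
      (schur_compl B v a * 0\<^sub>m n 1 + ?c * 1\<^sub>m 1)
      (0\<^sub>m 1 n * 1\<^sub>m n + ?a * mat 1 n (\<lambda>(i, j). v $ j / a)) (0\<^sub>m 1 n * 0\<^sub>m n 1 + ?a * 1\<^sub>m 1)"
    by (rule mult_four_block_mat[where ?nr1.0 = n]) (use S in auto)
  also have "\<dots> = four_block_mat B ?c ?r ?a"
  proof (rule cong_four_block_mat)
    show "schur_compl B v a * 1\<^sub>m n + ?c * mat 1 n (\<lambda>(i, j). v $ j / a) = B"
      by (rule eq_matI) (use B S v in \<open>auto simp: scalar_prod_def schur_compl_def\<close>)
    show "0\<^sub>m 1 n * 1\<^sub>m n + ?a * mat 1 n (\<lambda>(i, j). v $ j / a) = ?r"
      by (rule eq_matI) (use a in \<open>auto simp: scalar_prod_def\<close>)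
  qed (use S in auto)
  finally have "border B v a = ?U * ?L" by (simp add: border_four_block[OF B v])
  moreover have "det (?U * ?L) = det ?U * det ?L"
    by (rule det_mult[where n = "n + 1"]) (use S in auto)
  moreover have "det ?U = det (schur_compl B v a) * det ?a"
    by (rule det_four_block_mat_lower_left_zero) (use S in auto)
  moreover have "det ?L = det (1\<^sub>m n) * det (1\<^sub>m 1)"
    by (rule det_four_block_mat_upper_right_zero) auto
  ultimately show ?thesis by (simp add: det_single)
qed

text \<open>If the border is \<open>B w\<close>, subtracting from the last column the combination of the others
  with coefficients \<open>w\<close> leaves \<open>a - w\<^sup>T B w\<close> in the corner.\<close>

lemma det_border_in_range:
  fixes B :: "'a::field mat"
  assumes B: "B \<in> carrier_mat n n" and w: "w \<in> carrier_vec n" and sym: "B\<^sup>T = B"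
  shows "det (border B (B *\<^sub>v w) a) = det B * (a - quad_form B w)"
proof -
  let ?v = "B *\<^sub>v w"
  let ?c = "mat n 1 (\<lambda>(i, j). ?v $ i)" and ?r = "mat 1 n (\<lambda>(i, j). ?v $ j)" and ?a = "mat 1 1 (\<lambda>_. a)"
  let ?d = "mat 1 1 (\<lambda>_. a - quad_form B w)"
  let ?L = "four_block_mat B (0\<^sub>m n 1) ?r ?d"
  let ?U = "four_block_mat (1\<^sub>m n) (mat n 1 (\<lambda>(i, j). w $ i)) (0\<^sub>m 1 n) (1\<^sub>m 1)"
  have v: "?v \<in> carrier_vec n" using B w by simp
  have "?L * ?U = four_block_mat (B * 1\<^sub>m n + 0\<^sub>m n 1 * 0\<^sub>m 1 n)
      (B * mat n 1 (\<lambda>(i, j). w $ i) + 0\<^sub>m n 1 * 1\<^sub>m 1)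
      (?r * 1\<^sub>m n + ?d * 0\<^sub>m 1 n) (?r * mat n 1 (\<lambda>(i, j). w $ i) + ?d * 1\<^sub>m 1)"
    by (rule mult_four_block_mat[where ?nr1.0 = n]) (use B in auto)
  also have "\<dots> = four_block_mat B ?c ?r ?a"
  proof (rule cong_four_block_mat)
    show "B * mat n 1 (\<lambda>(i, j). w $ i) + 0\<^sub>m n 1 * 1\<^sub>m 1 = ?c"
      by (rule eq_matI) (use B w in \<open>auto simp: scalar_prod_def\<close>)
    show "?r * mat n 1 (\<lambda>(i, j). w $ i) + ?d * 1\<^sub>m 1 = ?a"
      by (rule eq_matI) (use B w in \<open>auto simp: scalar_prod_def quad_form_def mult.commute\<close>)
  qed (use B in auto)
  finally have "border B ?v a = ?L * ?U" by (simp add: border_four_block[OF B v])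
  moreover have "det (?L * ?U) = det ?L * det ?U"
    by (rule det_mult[where n = "n + 1"]) (use B in auto)
  moreover have "det ?U = det (1\<^sub>m n) * det (1\<^sub>m 1)"
    by (rule det_four_block_mat_lower_left_zero) auto
  moreover have "det ?L = det B * det ?d"
    by (rule det_four_block_mat_upper_right_zero) (use B in auto)
  ultimately show ?thesis by (simp add: det_single)
qed

definition snoc_vec :: "'a vec \<Rightarrow> 'a \<Rightarrow> 'a vec" where
  "snoc_vec w y = vec (Suc (dim_vec w)) (\<lambda>i. if i < dim_vec w then w $ i else y)"

lemma snoc_vec_carrier [simp]: "w \<in> carrier_vec n \<Longrightarrow> snoc_vec w y \<in> carrier_vec (Suc n)"
  by (auto simp: snoc_vec_def)

lemma bij_betw_snoc_vec:
  "bij_betw (\<lambda>(w, y). snoc_vec w y) (carrier_vec n \<times> UNIV) (carrier_vec (Suc n))"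
proof (rule bij_betw_byWitness[where f' = "\<lambda>v. (vec n (\<lambda>i. v $ i), v $ n)"])
  show "\<forall>p\<in>carrier_vec n \<times> UNIV. (vec n (\<lambda>i. (case p of (w, y) \<Rightarrow> snoc_vec w y) $ i), (case p of (w, y) \<Rightarrow> snoc_vec w y) $ n) = p"
    by (auto simp: snoc_vec_def)
  show "\<forall>v\<in>carrier_vec (Suc n). (case (vec n (\<lambda>i. v $ i), v $ n) of (w, y) \<Rightarrow> snoc_vec w y) = v"
    by (auto simp: snoc_vec_def less_Suc_eq intro!: eq_vecI)
qed (auto simp: snoc_vec_def)

lemma finite_carrier_vec [simp]: "finite (carrier_vec n :: 'a::finite vec set)"
proof (induction n)
  case 0
  have "carrier_vec 0 = {vec 0 (\<lambda>_. undefined :: 'a)}" by (auto intro!: eq_vecI)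
  then show ?case by simp
next
  case (Suc n)
  then show ?case using bij_betw_finite[OF bij_betw_snoc_vec, of n, where 'a1 = 'a] by simp
qed

lemma sum_carrier_vec_Suc:
  "(\<Sum>v\<in>carrier_vec (Suc n). g v) = (\<Sum>w\<in>carrier_vec n. \<Sum>y\<in>UNIV. g (snoc_vec w y))"
  for g :: "'a::finite vec \<Rightarrow> 'b::comm_monoid_add"
  by (simp add: sum.cartesian_product sum.reindex_bij_betw[OF bij_betw_snoc_vec, symmetric] case_prod_unfold)

lemma card_carrier_vec: "card (carrier_vec n :: 'a::finite vec set) = CARD('a) ^ n"
proof (induction n)
  case 0
  have "carrier_vec 0 = {vec 0 (\<lambda>_. undefined :: 'a)}" by (auto intro!: eq_vecI)
  then show ?case by simp
next
  case (Suc n)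
  then show ?case using bij_betw_same_card[OF bij_betw_snoc_vec, of n, where 'a1 = 'a] 
    by (simp add: card_cartesian_product mult.commute)
qed

text \<open>Completing the square in the last coordinate.\<close>

lemma quad_form_border_snoc:
  fixes B :: "'a::field mat"
  assumes "B \<in> carrier_mat n n" "v \<in> carrier_vec n" "w \<in> carrier_vec n" "a \<noteq> 0"
  shows "quad_form (border B v a) (snoc_vec w y)
           = quad_form (schur_compl B v a) w + a * (y + (v \<bullet> w) / a)\<^sup>2"
proof -
  have sc: "v \<bullet> w = (\<Sum>i<n. v $ i * w $ i)"
    using assms by (simp add: scalar_prod_def lessThan_atLeast0)
  have "quad_form (border B v a) (snoc_vec w y)
      = (\<Sum>i<n. (\<Sum>j<n. w $ i * B $$ (i, j) * w $ j) + w $ i * v $ i * y)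
        + ((\<Sum>j<n. y * v $ j * w $ j) + y * a * y)"
    using assms by (simp add: quad_form_sum[where n = "Suc n"]) (simp add: border_def snoc_vec_def)
  also have "\<dots> = (\<Sum>i<n. \<Sum>j<n. w $ i * B $$ (i, j) * w $ j) + 2 * y * (v \<bullet> w) + a * y\<^sup>2"
    by (simp add: sc sum.distrib sum_distrib_left sum_distrib_right power2_eq_square algebra_simps)
  finally have 1: "quad_form (border B v a) (snoc_vec w y)
      = (\<Sum>i<n. \<Sum>j<n. w $ i * B $$ (i, j) * w $ j) + 2 * y * (v \<bullet> w) + a * y\<^sup>2" .
  have "quad_form (schur_compl B v a) w
     = (\<Sum>i<n. \<Sum>j<n. w $ i * (B $$ (i, j) - v $ i * v $ j / a) * w $ j)"
    using assms by (simp add: quad_form_sum[where n = n]) (simp add: schur_compl_def)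
  also have "\<dots> = (\<Sum>i<n. \<Sum>j<n. w $ i * B $$ (i, j) * w $ j) - (v \<bullet> w) * (v \<bullet> w) / a"
    by (simp add: sc sum_product sum_subtractf[symmetric] sum_divide_distrib algebra_simps)
  finally have 2: "quad_form (schur_compl B v a) w
    = (\<Sum>i<n. \<Sum>j<n. w $ i * B $$ (i, j) * w $ j) - (v \<bullet> w) * (v \<bullet> w) / a" .
  show ?thesis unfolding 1 2 using assms(4) by (simp add: field_simps power2_eq_square)
qed

section \<open>Congruence and symmetric matrices with zeros on the diagonal\<close>

lemma bij_betw_mult_mat_vec:
  fixes A :: "'a::{finite,field} mat"
  assumes A: "A \<in> carrier_mat n n" and det: "det A \<noteq> 0"
  shows "bij_betw (\<lambda>w. A *\<^sub>v w) (carrier_vec n) (carrier_vec n)"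
proof -
  have "inj_on (\<lambda>w. A *\<^sub>v w) (carrier_vec n)"
  proof (rule inj_onI)
    fix v w assume vw: "v \<in> carrier_vec n" "w \<in> carrier_vec n" and eq: "A *\<^sub>v v = A *\<^sub>v w"
    have "A *\<^sub>v (v - w) = 0\<^sub>v n"
      using vw eq A by (simp add: mult_minus_distrib_mat_vec[OF A])
    then have "v - w = 0\<^sub>v n"
      using det_0_iff_vec_prod_zero_field[OF A] det vw by (meson minus_carrier_vec)
    then have "(v - w) $ i = 0" if "i < n" for i using that by simp
    then show "v = w" using vw by (intro eq_vecI) auto
  qed
  moreover have "(\<lambda>w. A *\<^sub>v w) ` carrier_vec n \<subseteq> carrier_vec n" using A by auto
  ultimately show ?thesis
    unfolding bij_betw_def using endo_inj_surj[OF finite_carrier_vec, of "\<lambda>w. A *\<^sub>v w" n] by blast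
qed

lemma quad_form_congruence:
  fixes A :: "'a::comm_ring_1 mat"
  assumes A: "A \<in> carrier_mat n n" and P: "P \<in> carrier_mat n n" and v: "v \<in> carrier_vec n"
  shows "quad_form (P * A * P\<^sup>T) v = quad_form A (P\<^sup>T *\<^sub>v v)"
proof -
  have w: "P\<^sup>T *\<^sub>v v \<in> carrier_vec n" using P v by simp
  have "(P * A * P\<^sup>T) *\<^sub>v v = P *\<^sub>v (A *\<^sub>v (P\<^sup>T *\<^sub>v v))"
    using assms w by (simp add: assoc_mult_mat_vec[of _ n n _ n])
  then show ?thesis
    using transpose_vec_mult_scalar[OF P _ v, of "A *\<^sub>v (P\<^sup>T *\<^sub>v v)"] A w
    by (simp add: quad_form_def)
qed

lemma congruence_diag:
  fixes A :: "'a::comm_ring_1 mat"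
  assumes A: "A \<in> carrier_mat n n" and P: "P \<in> carrier_mat n n" and i: "i < n"
  shows "(P * A * P\<^sup>T) $$ (i, i) = quad_form A (row P i)"
proof -
  have "P * A * P\<^sup>T = P * (A * P\<^sup>T)" using A P by (intro assoc_mult_mat[of _ n n _ n _ n]) auto
  then have "(P * A * P\<^sup>T) $$ (i, i) = row P i \<bullet> col (A * P\<^sup>T) i" using A P i by simp
  also have "col (A * P\<^sup>T) i = A *\<^sub>v row P i"
    using A P i by (subst col_mult2[of _ n n _ n]) auto
  finally show ?thesis by (simp add: quad_form_def)
qed

lemma det_congruence:
  fixes A :: "'a::idom mat"
  assumes A: "A \<in> carrier_mat n n" and P: "P \<in> carrier_mat n n"
  shows "det (P * A * P\<^sup>T) = (det P)\<^sup>2 * det A"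
  using assms by (simp add: det_mult[of _ n] det_transpose[OF P] power2_eq_square)

lemma transpose_congruence:
  fixes A :: "'a::comm_ring_1 mat"
  assumes A: "A \<in> carrier_mat n n" and P: "P \<in> carrier_mat n n" and sym: "A\<^sup>T = A"
  shows "(P * A * P\<^sup>T)\<^sup>T = P * A * P\<^sup>T"
  using assms by (simp add: transpose_mult[of _ n n _ n] assoc_mult_mat[of _ n n _ n _ n])

lemma quad_form_unit_vec:
  fixes A :: "'a::comm_ring_1 mat"
  assumes "A \<in> carrier_mat n n" "i < n"
  shows "quad_form A (unit_vec n i) = A $$ (i, i)"
  using assms by (simp add: quad_form_def scalar_prod_left_unit)

text \<open>The last diagonal entry of \<open>P A P\<^sup>T\<close> is the value of the form at the last row of \<open>P\<close>. A nonzero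
  diagonal entry of \<open>A\<close> is moved to the end by a transposition. If the diagonal is zero, some entry
  \<open>A $$ (i, j)\<close> is not, and adding row and column \<open>j\<close> to row and column \<open>i\<close> puts \<open>2 * A $$ (i, j)\<close> on
  the diagonal.\<close>

lemma exists_congruence_with_pivot:
  fixes A :: "'a::field mat"
  assumes A: "A \<in> carrier_mat (Suc n) (Suc n)" and sym: "A\<^sup>T = A" and det: "det A \<noteq> 0"
    and two: "(2 :: 'a) \<noteq> 0"
  shows "\<exists>P\<in>carrier_mat (Suc n) (Suc n). det P \<noteq> 0 \<and> (P * A * P\<^sup>T) $$ (n, n) \<noteq> 0"
proof -
  have swap: "\<exists>P\<in>carrier_mat (Suc n) (Suc n). det P \<noteq> 0 \<and> (P * C * P\<^sup>T) $$ (n, n) \<noteq> 0"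
    if C: "C \<in> carrier_mat (Suc n) (Suc n)" and i: "i \<le> n" "C $$ (i, i) \<noteq> 0" for C :: "'a mat" and i
  proof (cases "i = n")
    case True
    then show ?thesis using C i by (intro bexI[of _ "1\<^sub>m (Suc n)"]) auto
  next
    case False
    let ?P = "swaprows_mat (Suc n) i n :: 'a mat"
    have "(?P * C * ?P\<^sup>T) $$ (n, n) = C $$ (i, i)"
      using C i by (subst congruence_diag[of _ "Suc n"]) (auto simp: row_swaprows quad_form_unit_vec)
    moreover have "det ?P = - 1" using i False by (intro det_swaprows_mat) auto
    ultimately show ?thesis using i by (intro bexI[of _ ?P]) auto
  qed
  show ?thesis
  proof (cases "\<exists>i\<le>n. A $$ (i, i) \<noteq> 0")
    case True
    then show ?thesis using swap[OF A] by auto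
  next
    case False
    have "\<exists>i\<le>n. \<exists>j\<le>n. A $$ (i, j) \<noteq> 0"
    proof (rule ccontr)
      assume "\<not> ?thesis"
      then have "A = 0\<^sub>m (Suc n) (Suc n)" using A by (intro eq_matI) auto
      then show False using det det_zero[of "Suc n"] by simp
    qed
    then obtain i j where ij: "i \<le> n" "j \<le> n" "A $$ (i, j) \<noteq> 0" by auto
    with False have neq: "i \<noteq> j" by auto
    have ji: "A $$ (j, i) = A $$ (i, j)"
      using A ij sym by (metis carrier_matD index_transpose_mat(1) le_imp_less_Suc)
    let ?E = "addrow_mat (Suc n) 1 i j :: 'a mat"
    have E: "?E \<in> carrier_mat (Suc n) (Suc n)" by simp
    let ?u = "unit_vec (Suc n) i :: 'a vec" and ?v = "unit_vec (Suc n) j :: 'a vec"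
    have "(?E * A * ?E\<^sup>T) $$ (i, i) = quad_form A (row ?E i)"
      using A ij by (intro congruence_diag[of _ "Suc n"]) auto
    also have "row ?E i = ?v + ?u" using ij by (simp add: row_addrow)
    also have "quad_form A (?v + ?u) = 2 * A $$ (i, j)"
      using A ij False ji
      by (simp add: quad_form_def mult_add_distrib_mat_vec[OF A] add_scalar_prod_distrib[of _ "Suc n"]
          scalar_prod_add_distrib[of _ "Suc n"] scalar_prod_left_unit)
    finally have "(?E * A * ?E\<^sup>T) $$ (i, i) \<noteq> 0" using ij two by simp
    then obtain P where P: "P \<in> carrier_mat (Suc n) (Suc n)" "det P \<noteq> 0"
      "(P * (?E * A * ?E\<^sup>T) * P\<^sup>T) $$ (n, n) \<noteq> 0"
      using swap[OF _ ij(1), of "?E * A * ?E\<^sup>T"] A E by (meson mult_carrier_mat transpose_carrier_mat)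
    have "P * (?E * A * ?E\<^sup>T) * P\<^sup>T = (P * ?E) * A * (P * ?E)\<^sup>T"
    proof -
      note assoc = assoc_mult_mat[of _ "Suc n" "Suc n" _ "Suc n" _ "Suc n"]
      have "(P * ?E) * A * (P * ?E)\<^sup>T = P * ?E * A * (?E\<^sup>T * P\<^sup>T)"
        using transpose_mult[OF P(1) E] by simp
      also have "\<dots> = P * ?E * A * ?E\<^sup>T * P\<^sup>T"
        using P(1) A E by (intro assoc[symmetric]) auto
      also have "P * ?E * A * ?E\<^sup>T = P * (?E * A * ?E\<^sup>T)"
        using P(1) A E by (simp only: assoc mult_carrier_mat transpose_carrier_mat)
      finally show ?thesis by simp
    qed
    moreover have "det (P * ?E) = det P"
      using neq ij det_mult[OF P(1) E] det_addrow_mat[of i j "Suc n" "1 :: 'a"] by simp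
    ultimately show ?thesis using P E by (intro bexI[of _ "P * ?E"]) (auto simp del: index_mult_mat)
  qed
qed

text \<open>Singular matrices are included: summing a function of the determinant that vanishes at \<open>0\<close> over this
  set discards them, and without the invertibility condition the border can be chosen freely.\<close>

definition symm :: "nat \<Rightarrow> nat \<Rightarrow> 'a::zero mat set" where
  "symm n k = {A \<in> carrier_mat n n. A\<^sup>T = A \<and> (\<forall>i<k. A $$ (i, i) = 0)}"

lemma symm_sym: "A \<in> symm n k \<Longrightarrow> i < n \<Longrightarrow> j < n \<Longrightarrow> A $$ (i, j) = A $$ (j, i)"
  by (auto simp: symm_def) (metis carrier_matD index_transpose_mat(1))

lemma symm_iff:
  "A \<in> symm n k \<longleftrightarrow> A \<in> carrier_mat n n \<and> (\<forall>i<n. \<forall>j<n. A $$ (i, j) = A $$ (j, i)) \<and> (\<forall>i<k. A $$ (i, i) = 0)"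
  (is "_ \<longleftrightarrow> ?R")
proof
  assume R: ?R
  then have "A\<^sup>T = A" by (intro eq_matI) auto
  with R show "A \<in> symm n k" by (auto simp: symm_def)
next
  assume A: "A \<in> symm n k"
  then show ?R using symm_sym[OF A] by (simp add: symm_def)
qed

lemma finite_symm [simp]: "finite (symm n k :: 'a::{finite,zero} mat set)"
proof -
  have "symm n k \<subseteq> mat n n ` (({..<n} \<times> {..<n}) \<rightarrow>\<^sub>E (UNIV :: 'a set))"
  proof
    fix A :: "'a mat" assume "A \<in> symm n k"
    then have eq: "A = mat n n (restrict (\<lambda>p. A $$ p) ({..<n} \<times> {..<n}))"
      by (intro eq_matI) (auto simp: symm_def)
    show "A \<in> mat n n ` (({..<n} \<times> {..<n}) \<rightarrow>\<^sub>E UNIV)"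
      by (subst eq) (rule imageI, auto split: if_splits)
  qed
  then show ?thesis by (rule finite_subset) (intro finite_imageI finite_PiE, auto)
qed

lemma bij_betw_border:
  assumes "k \<le> n"
  shows "bij_betw (\<lambda>(B, v, a). border B v a)
    (symm n k \<times> carrier_vec n \<times> UNIV) (symm (Suc n) k :: 'a::zero mat set)"
proof (rule bij_betw_byWitness[where f' = "\<lambda>A. (mat n n (\<lambda>(i, j). A $$ (i, j)), vec n (\<lambda>i. A $$ (i, n)), A $$ (n, n))"])
  show "(\<lambda>(B, v, a). border B v a) ` (symm n k \<times> carrier_vec n \<times> UNIV) \<subseteq> symm (Suc n) k"
    using assms by (auto simp: symm_iff) (auto simp: border_def)
  show "(\<lambda>A. (mat n n (\<lambda>(i, j). A $$ (i, j)), vec n (\<lambda>i. A $$ (i, n)), A $$ (n, n))) ` symm (Suc n) k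
      \<subseteq> symm n k \<times> carrier_vec n \<times> UNIV"
    using assms by (auto simp: symm_iff)
  show "\<forall>A\<in>symm (Suc n) k :: 'a mat set. (case (mat n n (\<lambda>(i, j). A $$ (i, j)), vec n (\<lambda>i. A $$ (i, n)), A $$ (n, n))
      of (B, v, a) \<Rightarrow> border B v a) = A"
  proof
    fix A :: "'a mat" assume A: "A \<in> symm (Suc n) k"
    then have carrier: "A \<in> carrier_mat (Suc n) (Suc n)" by (simp add: symm_def)
    have "A $$ (n, j) = A $$ (j, n)" if "j < n" for j using symm_sym[OF A] that by simp
    with carrier show "(case (mat n n (\<lambda>(i, j). A $$ (i, j)), vec n (\<lambda>i. A $$ (i, n)), A $$ (n, n))
      of (B, v, a) \<Rightarrow> border B v a) = A"
      by (simp, intro eq_matI) (auto simp: border_def less_Suc_eq)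
  qed
  show "\<forall>p\<in>(symm n k :: 'a mat set) \<times> carrier_vec n \<times> UNIV. (mat n n (\<lambda>(i, j). (case p of (B, v, a) \<Rightarrow> border B v a) $$ (i, j)),
      vec n (\<lambda>i. (case p of (B, v, a) \<Rightarrow> border B v a) $$ (i, n)),
      (case p of (B, v, a) \<Rightarrow> border B v a) $$ (n, n)) = p"
  proof
    fix p :: "'a mat \<times> 'a vec \<times> 'a" assume "p \<in> (symm n k :: 'a mat set) \<times> carrier_vec n \<times> UNIV"
    then obtain B v a where p: "p = (B, v, a)" and B: "B \<in> symm n k" and v: "v \<in> carrier_vec n"
      by auto
    show "(mat n n (\<lambda>(i, j). (case p of (B, v, a) \<Rightarrow> border B v a) $$ (i, j)),
      vec n (\<lambda>i. (case p of (B, v, a) \<Rightarrow> border B v a) $$ (i, n)),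
      (case p of (B, v, a) \<Rightarrow> border B v a) $$ (n, n)) = p"
      unfolding p prod.case prod.inject
      by (intro conjI eq_matI eq_vecI) (use B v in \<open>auto simp: symm_iff border_def\<close>)
  qed
qed

lemma sum_symm_Suc:
  fixes g :: "'a::{finite,zero} mat \<Rightarrow> 'b::comm_monoid_add"
  assumes "k \<le> n"
  shows "(\<Sum>A\<in>symm (Suc n) k. g A) = (\<Sum>B\<in>symm n k. \<Sum>v\<in>carrier_vec n. \<Sum>a\<in>UNIV. g (border B v a))"
  by (simp add: sum.cartesian_product sum.reindex_bij_betw[OF bij_betw_border[OF assms], symmetric] case_prod_unfold)

section \<open>Representation numbers and determinant sums\<close>

definition num_reps :: "'a::{finite,comm_ring_1} mat \<Rightarrow> nat \<Rightarrow> 'a \<Rightarrow> real" where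
  "num_reps A n c = real (card {v \<in> carrier_vec n. quad_form A v = c})"

lemma num_reps_sum: "num_reps A n c = (\<Sum>v\<in>carrier_vec n. of_bool (quad_form A v = c))"
  unfolding num_reps_def by (subst sum_of_bool_eq) (auto intro!: arg_cong[where f = card])

lemma sum_over_quad_form:
  fixes g :: "'a::{finite,comm_ring_1} \<Rightarrow> real"
  shows "(\<Sum>v\<in>carrier_vec n. g (quad_form A v)) = (\<Sum>c\<in>UNIV. g c * num_reps A n c)"
proof -
  have "(\<Sum>c\<in>UNIV. g c * num_reps A n c)
      = (\<Sum>v\<in>carrier_vec n. \<Sum>c\<in>UNIV. g c * of_bool (quad_form A v = c))"
    unfolding num_reps_sum sum_distrib_left by (rule sum.swap)
  also have "\<dots> = (\<Sum>v\<in>carrier_vec n. g (quad_form A v))"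
    by (intro sum.cong refl) (simp add: of_bool_def if_distrib cong: if_cong)
  finally show ?thesis by simp
qed

lemma num_reps_congruence:
  fixes A :: "'a::{finite,field} mat"
  assumes A: "A \<in> carrier_mat n n" and P: "P \<in> carrier_mat n n" and det: "det P \<noteq> 0"
  shows "num_reps (P * A * P\<^sup>T) n c = num_reps A n c"
proof -
  have bij: "bij_betw (\<lambda>v. P\<^sup>T *\<^sub>v v) (carrier_vec n) (carrier_vec n)"
    by (rule bij_betw_mult_mat_vec) (use P det det_transpose[OF P] in auto)
  have "num_reps A n c = (\<Sum>v\<in>carrier_vec n. of_bool (quad_form A (P\<^sup>T *\<^sub>v v) = c))"
    unfolding num_reps_sum by (rule sum.reindex_bij_betw[OF bij, symmetric])
  then show ?thesis by (simp add: num_reps_sum quad_form_congruence[OF A P])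
qed

text \<open>For each vector \<open>w\<close>, the completed square is a shift of the last coordinate, so it can be replaced by
  \<open>a * y\<^sup>2\<close>.\<close>

lemma num_reps_border:
  fixes B :: "'a::{finite,field} mat"
  assumes B: "B \<in> carrier_mat n n" and v: "v \<in> carrier_vec n" and a: "a \<noteq> 0"
  shows "num_reps (border B v a) (Suc n) c = (\<Sum>y\<in>UNIV. num_reps (schur_compl B v a) n (c - a * y\<^sup>2))"
proof -
  have "num_reps (border B v a) (Suc n) c
    = (\<Sum>w\<in>carrier_vec n. \<Sum>y\<in>UNIV. of_bool (quad_form (schur_compl B v a) w + a * (y + (v \<bullet> w) / a)\<^sup>2 = c))"
    by (simp add: num_reps_sum sum_carrier_vec_Suc quad_form_border_snoc[OF B v _ a])
  also have "\<dots> = (\<Sum>w\<in>carrier_vec n. \<Sum>y\<in>UNIV. of_bool (quad_form (schur_compl B v a) w + a * y\<^sup>2 = c))"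
    by (intro sum.cong refl sum_shift_reindex)
  also have "\<dots> = (\<Sum>w\<in>carrier_vec n. \<Sum>y\<in>UNIV. of_bool (quad_form (schur_compl B v a) w = c - a * y\<^sup>2))"
    by (simp add: eq_diff_eq)
  finally show ?thesis by (subst (asm) sum.swap) (simp add: num_reps_sum)
qed

text \<open>The classical number of solutions of \<open>Q v = c\<close> for a nondegenerate quadratic form \<open>Q\<close> in \<open>n\<close>
  variables of determinant \<open>d\<close>. The main term is \<open>q ^ (n - 1)\<close>, written as a quotient so that the formula
  also holds for \<open>n = 0\<close>.\<close>

definition reps_value :: "nat \<Rightarrow> 'a::{finite,field} \<Rightarrow> 'a \<Rightarrow> real" where
  "reps_value n d c = real CARD('a) ^ n / real CARD('a) +
     (if even n
      then quad_char ((-1) ^ (n div 2) * d) * (real CARD('a) ^ (n div 2) / real CARD('a))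
             * ((if c = 0 then real CARD('a) else 0) - 1)
      else quad_char ((-1) ^ (n div 2) * d * c) * real CARD('a) ^ (n div 2))"

text \<open>Adding a variable alternates between the two cases of \<open>reps_value\<close>: from even to odd size the correction
  is summed by counting the \<open>y\<close> with \<open>a * y\<^sup>2 = c\<close>, from odd to even size by evaluating the
  character sum of \<open>c - a * y\<^sup>2\<close>.\<close>

lemma reps_value_Suc:
  assumes odd: "odd CARD('a::{finite,field})" and a: "(a :: 'a) \<noteq> 0"
  shows "(\<Sum>y\<in>UNIV. reps_value n d (c - a * y\<^sup>2)) = reps_value (Suc n) (a * d) c"
proof -
  let ?q = "real CARD('a)"
  have q: "?q > 0" by simp
  note mult = quad_char_mult[OF odd]
  have linear: "(\<Sum>y\<in>(UNIV :: 'a set). K + L * (M * h y - N)) = ?q * K + L * (M * (\<Sum>y\<in>UNIV. h y) - ?q * N)"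
    for K L M N :: real and h :: "'a \<Rightarrow> real"
    by (simp add: sum.distrib sum_subtractf sum_distrib_left[symmetric])
  show ?thesis
  proof (cases "even n")
    case True
    then obtain m where n: "n = 2 * m" by blast
    let ?e = "quad_char ((-1) ^ m * d :: 'a)"
    have "(\<Sum>y\<in>UNIV. reps_value n d (c - a * y\<^sup>2))
        = (\<Sum>y\<in>(UNIV :: 'a set). ?q ^ n / ?q + ?e * (?q ^ m / ?q) * (?q * of_bool (c = a * y\<^sup>2) - 1))"
      by (simp add: reps_value_def n of_bool_def if_distrib cong: if_cong)
    also have "\<dots> = ?q ^ n + ?e * (?q ^ m / ?q) * (?q * (\<Sum>y\<in>(UNIV :: 'a set). of_bool (c = a * y\<^sup>2)) - ?q)"
      unfolding linear using q by simp
    also have "(\<Sum>y\<in>(UNIV :: 'a set). of_bool (c = a * y\<^sup>2)) = 1 + quad_char (a * c)"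
      by (simp add: sum_of_bool_eq card_scaled_square_roots[OF odd a])
    also have "?q ^ n + ?e * (?q ^ m / ?q) * (?q * (1 + quad_char (a * c)) - ?q)
        = ?q ^ n + ?e * quad_char (a * c) * ?q ^ m"
      using q by (simp add: field_simps)
    also have "?e * quad_char (a * c) = quad_char ((-1) ^ m * (a * d) * c)"
      by (simp add: mult ac_simps)
    finally show ?thesis using n q by (simp add: reps_value_def)
  next
    case False
    then obtain m where n: "n = 2 * m + 1" using oddE by blast
    let ?e = "quad_char ((-1) ^ m * d :: 'a)"
    have "(\<Sum>y\<in>UNIV. reps_value n d (c - a * y\<^sup>2))
        = (\<Sum>y\<in>(UNIV :: 'a set). ?q ^ n / ?q + ?e * ?q ^ m * quad_char (c - a * y\<^sup>2))"
      by (simp add: reps_value_def n mult ac_simps)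
    also have "\<dots> = ?q ^ n + ?e * ?q ^ m * (\<Sum>y\<in>(UNIV :: 'a set). quad_char (c - a * y\<^sup>2))"
      using q by (simp add: sum.distrib sum_distrib_left[symmetric])
    also have "\<dots> = ?q ^ n + (?e * quad_char (- a)) * ?q ^ m * ((if c = 0 then ?q else 0) - 1)"
      by (simp only: sum_quad_char_quadratic[OF odd a] mult.assoc mult.commute mult.left_commute)
    also have "?e * quad_char (- a) = quad_char ((-1) ^ Suc m * (a * d))"
      by (simp add: mult[symmetric] ac_simps)
    finally show ?thesis using n q by (simp add: reps_value_def)
  qed
qed

lemma reps_value_mult_square:
  assumes "r \<noteq> 0"
  shows "reps_value n (r\<^sup>2 * d) c = reps_value n d c"
  unfolding reps_value_def
  using quad_char_mult_square[OF assms, of "(-1) ^ (n div 2) * d"]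
    quad_char_mult_square[OF assms, of "(-1) ^ (n div 2) * d * c"]
  by (simp add: ac_simps)

text \<open>Induction on the size: a congruence produces a nonzero last diagonal entry, which splits off one
  variable. A congruence changes neither the representation numbers nor the square class of the determinant.\<close>

theorem num_reps_nonsingular:
  assumes odd: "odd CARD('a::{finite,field})"
  assumes "A \<in> carrier_mat n n" "A\<^sup>T = A" "det A \<noteq> 0"
  shows "num_reps (A :: 'a mat) n c = reps_value n (det A) c"
  using assms(2-)
proof (induction n arbitrary: A c)
  case 0
  have "(carrier_vec 0 :: 'a vec set) = {vec 0 (\<lambda>_. 0)}" by (auto intro!: eq_vecI)
  moreover have "quad_form A (vec 0 (\<lambda>_. 0)) = 0" using 0 by (simp add: quad_form_def scalar_prod_def)
  moreover have "det A = 1" using 0 by simp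
  ultimately show ?case by (simp add: num_reps_sum reps_value_def field_simps)
next
  case (Suc n)
  obtain P where P: "P \<in> carrier_mat (Suc n) (Suc n)" "det P \<noteq> 0" "(P * A * P\<^sup>T) $$ (n, n) \<noteq> 0"
    using exists_congruence_with_pivot[OF Suc.prems two_neq_zero[OF odd]] by blast
  define C where "C = P * A * P\<^sup>T"
  have C: "C \<in> symm (Suc n) 0"
    using transpose_congruence[OF Suc.prems(1) P(1) Suc.prems(2)] P(1) Suc.prems(1)
    by (simp add: symm_def C_def)
  obtain B v a where B: "B \<in> symm n 0" and v: "v \<in> carrier_vec n" and C_border: "C = border B v a"
    using C unfolding bij_betw_imp_surj_on[OF bij_betw_border[OF le0], symmetric] by auto
  have B': "B \<in> carrier_mat n n" using B by (simp add: symm_def)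
  let ?S = "schur_compl B v a"
  have a: "a \<noteq> 0" using P(3) v unfolding C_def[symmetric] C_border by (simp add: border_def)
  have det_C: "(det P)\<^sup>2 * det A = a * det ?S"
    using det_congruence[OF Suc.prems(1) P(1)] det_border_schur[OF B' v a] by (simp add: C_def[symmetric] C_border)
  have S: "?S \<in> symm n 0" using B v by (auto simp: symm_iff schur_compl_def)
  have IH: "num_reps ?S n c = reps_value n (det ?S) c" for c
    using S det_C Suc.prems(3) P(2) by (intro Suc.IH) (auto simp: symm_def)
  have "num_reps A (Suc n) c = num_reps C (Suc n) c"
    using num_reps_congruence[OF Suc.prems(1) P(1,2)] by (simp add: C_def)
  also have "\<dots> = reps_value (Suc n) (a * det ?S) c"
    by (simp add: C_border num_reps_border[OF B' v a] IH reps_value_Suc[OF odd a])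
  also have "\<dots> = reps_value (Suc n) (det A) c"
    unfolding det_C[symmetric] by (rule reps_value_mult_square[OF P(2)])
  finally show ?case .
qed

definition symm_sum :: "('a::{finite,field} \<Rightarrow> real) \<Rightarrow> nat \<Rightarrow> nat \<Rightarrow> real" where
  "symm_sum f n k = (\<Sum>A\<in>symm n k. f (det A))"

lemma symm_sum_0: "symm_sum f 0 0 = f (1 :: 'a::{finite,field})"
proof -
  have "symm 0 0 = {1\<^sub>m 0 :: 'a mat}" by (auto simp: symm_iff)
  then show ?thesis by (simp add: symm_sum_def)
qed

text \<open>Exchanging the indices \<open>k\<close> and \<open>n\<close> turns the condition that entry \<open>k\<close> of the diagonal vanishes
  into the condition that the corner of the bordered matrix vanishes.\<close>

lemma symm_sum_last_diag_0:
  fixes f :: "'a::{finite,field} \<Rightarrow> real"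
  assumes k: "k \<le> n"
  shows "symm_sum f (Suc n) (Suc k) = (\<Sum>B\<in>symm n k. \<Sum>v\<in>carrier_vec n. f (det (border B v 0)))"
proof -
  let ?P = "swaprows_mat (Suc n) k n :: 'a mat"
  let ?T = "\<lambda>A. mat (Suc n) (Suc n) (\<lambda>(i, j). A $$ (Transposition.transpose k n i, Transposition.transpose k n j)) :: 'a mat"
  have tr: "Transposition.transpose k n i < Suc n" if "i < Suc n" for i
    using that k by (auto simp: Transposition.transpose_def)
  have det_T: "det (?T A) = det A" if A: "A \<in> carrier_mat (Suc n) (Suc n)" for A
  proof (cases "k = n")
    case True
    then have "?T A = A" using A by (intro eq_matI) auto
    then show ?thesis by simp
  next
    case False
    have "?T A = swapcols k n (swaprows k n A)"
      using A k by (intro eq_matI) (auto simp: Transposition.transpose_def)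
    also have "\<dots> = swapcols k n (?P * A)"
      using A k by (subst swaprows_mat[OF A]) auto
    also have "\<dots> = ?P * A * ?P"
      by (rule swapcols_mat) (use A k in auto)
    finally have "det (?T A) = det ?P * det A * det ?P"
      using det_mult[of "?P * A" "Suc n" ?P] det_mult[of ?P "Suc n" A] A by simp
    then show ?thesis using False k det_swaprows_mat[of k "Suc n" n, where 'a = 'a] by simp
  qed
  have inv: "?T (?T A) = A" if "A \<in> carrier_mat (Suc n) (Suc n)" for A
  proof (rule eq_matI)
    fix i j assume "i < dim_row A" "j < dim_col A"
    then show "?T (?T A) $$ (i, j) = A $$ (i, j)" using that tr by simp
  qed (use that in auto)
  have T_symm: "?T A \<in> carrier_mat (Suc n) (Suc n)
      \<and> (\<forall>i<Suc n. \<forall>j<Suc n. ?T A $$ (i, j) = ?T A $$ (j, i))" if A: "A \<in> symm (Suc n) l" for A l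
    using symm_sym[OF A tr tr] by simp
  have "symm_sum f (Suc n) (Suc k) = (\<Sum>A | A \<in> symm (Suc n) k \<and> A $$ (n, n) = 0. f (det A))"
    unfolding symm_sum_def
  proof (rule sum.reindex_bij_witness[of _ ?T ?T])
    fix A :: "'a mat" assume A: "A \<in> symm (Suc n) (Suc k)"
    then have carrier: "A \<in> carrier_mat (Suc n) (Suc n)" and diag: "\<And>i. i \<le> k \<Longrightarrow> A $$ (i, i) = 0"
      by (auto simp: symm_def)
    show "?T (?T A) = A" by (rule inv[OF carrier])
    show "f (det (?T A)) = f (det A)" by (simp only: det_T[OF carrier])
    have "?T A $$ (i, i) = 0" if "i < k \<or> i = n" for i
      using that k diag by (auto simp: Transposition.transpose_def)
    then show "?T A \<in> {A \<in> symm (Suc n) k. A $$ (n, n) = 0}"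
      unfolding symm_iff[of "?T A"] mem_Collect_eq using T_symm[OF A] by blast
  next
    fix A :: "'a mat" assume A: "A \<in> {A \<in> symm (Suc n) k. A $$ (n, n) = 0}"
    then have A': "A \<in> symm (Suc n) k" by simp
    with A have carrier: "A \<in> carrier_mat (Suc n) (Suc n)" and diag: "\<And>i. i < k \<or> i = n \<Longrightarrow> A $$ (i, i) = 0"
      by (auto simp: symm_def)
    show "?T (?T A) = A" by (rule inv[OF carrier])
    have "?T A $$ (i, i) = 0" if "i < Suc k" for i
      using that k diag by (auto simp: Transposition.transpose_def)
    then show "?T A \<in> symm (Suc n) (Suc k)"
      unfolding symm_iff[of "?T A"] using T_symm[OF A'] by blast
  qed
  also have "\<dots> = (\<Sum>A\<in>symm (Suc n) k. if A $$ (n, n) = 0 then f (det A) else 0)"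
    by (simp add: sum.inter_filter)
  also have "\<dots> = (\<Sum>B\<in>symm n k. \<Sum>v\<in>carrier_vec n. \<Sum>a\<in>UNIV. if a = 0 then f (det (border B v a)) else 0)"
    unfolding sum_symm_Suc[OF k] by (intro sum.cong refl) (simp add: border_def)
  finally show ?thesis by simp
qed

text \<open>Compare, for each \<open>B\<close>, a free corner with the corner \<open>0\<close>. For singular \<open>B\<close> the determinant ignores the
  corner and the two contributions cancel. For invertible \<open>B\<close> a free corner makes the determinant run
  once through the field, and for the corner \<open>0\<close> the substitution \<open>v = B w\<close> makes it \<open>- det B * Q w\<close>.\<close>

theorem symm_sum_diag_recursion:
  fixes f :: "'a::{finite,field} \<Rightarrow> real"
  assumes k: "k \<le> n"
  defines "q \<equiv> real CARD('a)"
  shows "symm_sum f (Suc n) k - q * symm_sum f (Suc n) (Suc k) =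
    (\<Sum>B | B \<in> symm n k \<and> det B \<noteq> 0.
       q ^ n * (\<Sum>x\<in>UNIV. f x) - q * (\<Sum>c\<in>UNIV. f (- det B * c) * num_reps B n c))"
proof -
  define g where "g B = (\<Sum>v\<in>carrier_vec n. (\<Sum>a\<in>UNIV. f (det (border B v a))) - q * f (det (border B v 0)))" for B
  have "symm_sum f (Suc n) k - q * symm_sum f (Suc n) (Suc k) = (\<Sum>B\<in>symm n k. g B)"
    unfolding symm_sum_last_diag_0[OF k] g_def
    by (simp add: symm_sum_def sum_symm_Suc[OF k] sum_subtractf sum_distrib_left)
  also have "\<dots> = (\<Sum>B\<in>symm n k. if det B \<noteq> 0 then
       q ^ n * (\<Sum>x\<in>UNIV. f x) - q * (\<Sum>c\<in>UNIV. f (- det B * c) * num_reps B n c) else 0)"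
  proof (rule sum.cong[OF refl])
    fix B :: "'a mat" assume "B \<in> symm n k"
    then have B: "B \<in> carrier_mat n n" "B\<^sup>T = B" by (auto simp: symm_def)
    have g: "g B = (\<Sum>v\<in>carrier_vec n. (\<Sum>a\<in>UNIV. f (det B * a + det (border B v 0))) - q * f (det (border B v 0)))"
      unfolding g_def
    proof (rule sum.cong[OF refl])
      fix v :: "'a vec" assume v: "v \<in> carrier_vec n"
      have *: "det (border B v a) = det B * a + det (border B v 0)" for a
        using det_border_affine[OF B(1) v, of a] by (simp only: mult.commute)
      show "(\<Sum>a\<in>UNIV. f (det (border B v a))) - q * f (det (border B v 0))
          = (\<Sum>a\<in>UNIV. f (det B * a + det (border B v 0))) - q * f (det (border B v 0))"
        by (rule arg_cong2[where f = "(-)"], rule sum.cong[OF refl], rule arg_cong[where f = f], rule *, rule refl)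
    qed
    show "g B = (if det B \<noteq> 0 then
       q ^ n * (\<Sum>x\<in>UNIV. f x) - q * (\<Sum>c\<in>UNIV. f (- det B * c) * num_reps B n c) else 0)"
    proof (cases "det B = 0")
      case True
      then show ?thesis unfolding g by (simp add: q_def)
    next
      case False
      have "(\<Sum>v\<in>carrier_vec n. f (det (border B v 0)))
          = (\<Sum>w\<in>carrier_vec n. f (det (border B (B *\<^sub>v w) 0)))"
        by (rule sum.reindex_bij_betw[OF bij_betw_mult_mat_vec[OF B(1) False], symmetric])
      also have "\<dots> = (\<Sum>w\<in>carrier_vec n. f (- det B * quad_form B w))"
        using B by (intro sum.cong refl) (simp add: det_border_in_range)
      also have "\<dots> = (\<Sum>c\<in>UNIV. f (- det B * c) * num_reps B n c)"
        by (rule sum_over_quad_form)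
      finally show ?thesis unfolding g using False
        by (simp add: sum_affine_reindex sum_subtractf sum_distrib_left[symmetric] card_carrier_vec q_def)
    qed
  qed
  finally show ?thesis by (simp only: sum.inter_filter[OF finite_symm])
qed

text \<open>When the corner \<open>a\<close> is nonzero, \<open>B\<close> can be replaced by its Schur complement, which runs over all symmetric
  matrices as \<open>B\<close> does; the determinant then factors. The remaining term is the one with corner \<open>0\<close>.\<close>

theorem symm_sum_pivot_recursion:
  fixes f :: "'a::{finite,field} \<Rightarrow> real"
  assumes f0: "f 0 = 0" and mult: "\<And>x y. f (x * y) = f x * f y"
  shows "symm_sum f (Suc n) 0 = real CARD('a) ^ n * (\<Sum>x\<in>UNIV. f x) * symm_sum f n 0 + symm_sum f (Suc n) 1"
proof -
  have schur: "(\<Sum>B\<in>symm n 0. f (det (border B v a))) = f a * symm_sum f n 0"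
    if v: "v \<in> carrier_vec n" and a: "a \<noteq> 0" for v a
  proof -
    have "(\<Sum>B\<in>symm n 0. f (det (border B v a))) = (\<Sum>S\<in>symm n 0. f (a * det S))"
    proof (rule sum.reindex_bij_witness[of _ "\<lambda>S. schur_compl S v (- a)" "\<lambda>B. schur_compl B v a"])
      fix B :: "'a mat" assume B: "B \<in> symm n 0"
      show "schur_compl (schur_compl B v a) v (- a) = B"
        using B v by (intro eq_matI) (auto simp: symm_def schur_compl_def)
      show "schur_compl (schur_compl B v (- a)) v a = B"
        using B v by (intro eq_matI) (auto simp: symm_def schur_compl_def)
      show "schur_compl B v a \<in> symm n 0" "schur_compl B v (- a) \<in> symm n 0"
        using B v by (auto simp: symm_iff schur_compl_def)
      show "f (a * det (schur_compl B v a)) = f (det (border B v a))"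
        using B v a by (subst det_border_schur) (auto simp: symm_def)
    qed
    then show ?thesis by (simp add: mult symm_sum_def sum_distrib_left)
  qed
  have "symm_sum f (Suc n) 0 = (\<Sum>v\<in>carrier_vec n. \<Sum>a\<in>UNIV. \<Sum>B\<in>symm n 0. f (det (border B v a)))"
    unfolding symm_sum_def sum_symm_Suc[OF le0] by (subst sum.swap, subst sum.swap) (rule refl)
  also have "\<dots> = (\<Sum>v\<in>carrier_vec n. (\<Sum>a\<in>UNIV - {0}. f a * symm_sum f n 0) + (\<Sum>B\<in>symm n 0. f (det (border B v 0))))"
  proof (rule sum.cong[OF refl])
    fix v :: "'a vec" assume v: "v \<in> carrier_vec n"
    show "(\<Sum>a\<in>UNIV. \<Sum>B\<in>symm n 0. f (det (border B v a)))
        = (\<Sum>a\<in>UNIV - {0}. f a * symm_sum f n 0) + (\<Sum>B\<in>symm n 0. f (det (border B v 0)))"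
      by (subst sum.remove[of _ 0]) (simp_all add: schur[OF v])
  qed
  also have "(\<Sum>a\<in>UNIV - {0}. f a * symm_sum f n 0) = (\<Sum>x\<in>UNIV. f x) * symm_sum f n 0"
    by (subst sum.remove[of UNIV 0]) (simp_all add: f0 sum_distrib_right)
  also have "(\<Sum>v\<in>carrier_vec n. (\<Sum>x\<in>UNIV. f x) * symm_sum f n 0 + (\<Sum>B\<in>symm n 0. f (det (border B v 0))))
      = real CARD('a) ^ n * (\<Sum>x\<in>UNIV. f x) * symm_sum f n 0 + symm_sum f (Suc n) 1"
    using symm_sum_last_diag_0[of 0 n f]
    by (simp add: sum.distrib card_carrier_vec) (rule sum.swap)
  finally show ?thesis .
qed

section \<open>The recursions for the two characters\<close>

text \<open>The trivial multiplicative character, extended by \<open>0\<close>. Summing it over determinants counts invertible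
  matrices.\<close>

definition nonzero_char :: "'a::field \<Rightarrow> real" where
  "nonzero_char x = of_bool (x \<noteq> 0)"

lemma sum_nonzero_char: "(\<Sum>x\<in>UNIV. nonzero_char (x :: 'a::{finite,field})) = real CARD('a) - 1"
proof -
  have "nonzero_char x = 1 - (if x = 0 then 1 else 0)" for x :: 'a
    by (simp add: nonzero_char_def)
  then show ?thesis by (simp add: sum_subtractf)
qed

lemma symm_sum_nonsingular:
  assumes "f 0 = 0"
  shows "symm_sum f n k = (\<Sum>B | B \<in> symm n k \<and> det B \<noteq> 0. f (det B))"
  unfolding symm_sum_def
  by (rule sum.mono_neutral_right) (use assms in auto)

lemma symm_sum_nonzero_char:
  "symm_sum (nonzero_char :: 'a::{finite,field} \<Rightarrow> real) n k = real (card {B :: 'a mat. B \<in> symm n k \<and> det B \<noteq> 0})"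
  by (subst symm_sum_nonsingular) (simp_all add: nonzero_char_def)

lemma card_field_gt_1: "real CARD('a::{finite,field}) > 1"
proof -
  have "card {0, 1 :: 'a} \<le> CARD('a)" by (rule card_mono) auto
  then show ?thesis by simp
qed

lemma sum_nonzero_char_reps:
  fixes B :: "'a::{finite,field} mat"
  assumes "det B \<noteq> 0"
  shows "(\<Sum>c\<in>UNIV. nonzero_char (- det B * c) * num_reps B n c) = real CARD('a) ^ n - num_reps B n 0"
proof -
  have "(\<Sum>c\<in>UNIV. num_reps B n c) = real CARD('a) ^ n"
    using sum_over_quad_form[of "\<lambda>_. 1" B n] by (simp add: card_carrier_vec)
  moreover have "(\<Sum>c\<in>UNIV. nonzero_char (- det B * c) * num_reps B n c) = (\<Sum>c\<in>UNIV - {0}. num_reps B n c)"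
    by (rule sum.mono_neutral_cong_right) (use assms in \<open>auto simp: nonzero_char_def\<close>)
  ultimately show ?thesis by (simp add: sum_diff1)
qed

lemma count_diag_recursion:
  assumes k: "k \<le> n"
  defines "q \<equiv> real CARD('a::{finite,field})"
  shows "symm_sum (nonzero_char :: 'a \<Rightarrow> real) (Suc n) k - q * symm_sum (nonzero_char :: 'a \<Rightarrow> real) (Suc n) (Suc k)
    = (\<Sum>B | B \<in> symm n k \<and> det B \<noteq> (0 :: 'a). q * num_reps B n 0 - q ^ n)"
  unfolding q_def symm_sum_diag_recursion[OF k]
proof (rule sum.cong[OF refl])
  fix B :: "'a mat" assume "B \<in> {B. B \<in> symm n k \<and> det B \<noteq> 0}"
  then have "det B \<noteq> 0" by simp
  then show "real CARD('a) ^ n * (\<Sum>x\<in>UNIV. nonzero_char (x :: 'a))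
      - real CARD('a) * (\<Sum>c\<in>UNIV. nonzero_char (- det B * c) * num_reps B n c)
    = real CARD('a) * num_reps B n 0 - real CARD('a) ^ n"
    unfolding sum_nonzero_char_reps[OF \<open>det B \<noteq> 0\<close>] sum_nonzero_char by (simp add: algebra_simps)
qed

text \<open>In even dimension \<open>2 m\<close>, the number of zeros of the form deviates from \<open>q ^ (2 * m - 1)\<close> by a term
  with the sign \<open>\<chi> ((-1) ^ m * det B)\<close>; this is how the character sum enters the count.\<close>

lemma count_odd_recursion:
  assumes odd: "odd CARD('a::{finite,field})" and k: "k \<le> 2 * m"
  defines "q \<equiv> real CARD('a)"
  shows "symm_sum (nonzero_char :: 'a \<Rightarrow> real) (2 * m + 1) k - q * symm_sum (nonzero_char :: 'a \<Rightarrow> real) (2 * m + 1) (k + 1)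
    = q ^ m * (q - 1) * (quad_char ((-1) ^ m :: 'a) * symm_sum (quad_char :: 'a \<Rightarrow> real) (2 * m) k)"
proof -
  have q: "q > 1" unfolding q_def by (rule card_field_gt_1)
  have "symm_sum (nonzero_char :: 'a \<Rightarrow> real) (2 * m + 1) k - q * symm_sum (nonzero_char :: 'a \<Rightarrow> real) (2 * m + 1) (k + 1)
    = (\<Sum>B | B \<in> symm (2 * m) k \<and> det B \<noteq> (0 :: 'a). q * num_reps B (2 * m) 0 - q ^ (2 * m))"
    using count_diag_recursion[OF k, where 'a = 'a] by (simp only: q_def Suc_eq_plus1)
  also have "\<dots> = (\<Sum>B | B \<in> symm (2 * m) k \<and> det B \<noteq> (0 :: 'a). q ^ m * (q - 1) * quad_char ((-1) ^ m :: 'a) * quad_char (det B))"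
  proof (rule sum.cong[OF refl])
    fix B :: "'a mat" assume "B \<in> {B. B \<in> symm (2 * m) k \<and> det B \<noteq> 0}"
    then have "num_reps B (2 * m) 0 = reps_value (2 * m) (det B) 0"
      by (intro num_reps_nonsingular[OF odd]) (auto simp: symm_def)
    also have "\<dots> = q ^ (2 * m) / q + quad_char ((-1) ^ m :: 'a) * quad_char (det B) * (q ^ m / q) * (q - 1)"
      by (simp add: reps_value_def q_def quad_char_mult[OF odd])
    finally show "q * num_reps B (2 * m) 0 - q ^ (2 * m)
        = q ^ m * (q - 1) * quad_char ((-1) ^ m :: 'a) * quad_char (det B)"
      using q by (simp add: field_simps)
  qed
  finally show ?thesis by (simp add: symm_sum_nonsingular[of quad_char] sum_distrib_left mult.assoc)
qed

text \<open>In odd dimension the number of zeros of the form is exactly \<open>q ^ (n - 1)\<close>, for every invertible \<open>B\<close>.\<close>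

lemma count_even_recursion:
  assumes odd: "odd CARD('a::{finite,field})" and k: "k \<le> 2 * m + 1"
  shows "symm_sum (nonzero_char :: 'a \<Rightarrow> real) (2 * m + 2) k
    = real CARD('a) * symm_sum (nonzero_char :: 'a \<Rightarrow> real) (2 * m + 2) (k + 1)"
proof -
  define q where "q = real CARD('a)"
  have q: "q > 1" unfolding q_def by (rule card_field_gt_1)
  have "symm_sum (nonzero_char :: 'a \<Rightarrow> real) (Suc (2 * m + 1)) k - q * symm_sum (nonzero_char :: 'a \<Rightarrow> real) (Suc (2 * m + 1)) (Suc k)
    = (\<Sum>B | B \<in> symm (2 * m + 1) k \<and> det B \<noteq> (0 :: 'a). q * num_reps B (2 * m + 1) 0 - q ^ (2 * m + 1))"
    unfolding q_def by (rule count_diag_recursion[OF k])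
  also have "\<dots> = 0"
  proof (rule sum.neutral, rule ballI)
    fix B :: "'a mat" assume "B \<in> {B. B \<in> symm (2 * m + 1) k \<and> det B \<noteq> 0}"
    then have "num_reps B (2 * m + 1) 0 = reps_value (2 * m + 1) (det B) 0"
      by (intro num_reps_nonsingular[OF odd]) (auto simp: symm_def)
    also have "\<dots> = q ^ (2 * m)"
      using q by (simp add: reps_value_def q_def)
    finally show "q * num_reps B (2 * m + 1) 0 - q ^ (2 * m + 1) = 0"
      by (simp add: algebra_simps)
  qed
  finally show ?thesis by (simp add: q_def)
qed

lemma quad_char_mult_self: 
  assumes "x \<noteq> 0" shows "quad_char x * quad_char x = 1"
  using assms by (auto simp: quad_char_def)

text \<open>In odd dimension, \<open>\<chi> (- det B * c)\<close> is, up to a sign independent of \<open>B\<close>, the character that governs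
  how often the form of \<open>B\<close> represents \<open>c\<close>. The product of the two is a constant for \<open>c \<noteq> 0\<close>, so each
  invertible \<open>B\<close> contributes the same amount.\<close>

lemma signed_even_recursion:
  assumes odd: "odd CARD('a::{finite,field})" and k: "k \<le> 2 * m + 1"
  defines "q \<equiv> real CARD('a)" and "Y \<equiv> \<lambda>k. quad_char ((-1) ^ (m + 1) :: 'a) * symm_sum (quad_char :: 'a \<Rightarrow> real) (2 * m + 2) k"
  shows "Y k - q * Y (k + 1) = - (q ^ (m + 1) * (q - 1) * symm_sum (nonzero_char :: 'a \<Rightarrow> real) (2 * m + 1) k)"
proof -
  let ?e = "quad_char ((-1) ^ (m + 1) :: 'a)"
  have q: "q > 1" unfolding q_def by (rule card_field_gt_1)
  have "symm_sum (quad_char :: 'a \<Rightarrow> real) (Suc (2 * m + 1)) k - q * symm_sum (quad_char :: 'a \<Rightarrow> real) (Suc (2 * m + 1)) (Suc k)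
    = (\<Sum>B | B \<in> symm (2 * m + 1) k \<and> det B \<noteq> (0 :: 'a). - (q * (\<Sum>c\<in>UNIV. quad_char (- det B * c) * num_reps B (2 * m + 1) c)))"
    using symm_sum_diag_recursion[OF k, of "quad_char :: 'a \<Rightarrow> real"]
    by (simp only: sum_quad_char[OF odd] q_def mult_zero_right diff_0)
  also have "\<dots> = (\<Sum>B | B \<in> symm (2 * m + 1) k \<and> det B \<noteq> (0 :: 'a). - (q ^ (m + 1) * (q - 1) * ?e))"
  proof (rule sum.cong[OF refl])
    fix B :: "'a mat" assume B: "B \<in> {B. B \<in> symm (2 * m + 1) k \<and> det B \<noteq> 0}"
    have reps: "num_reps B (2 * m + 1) c = q ^ (2 * m) + quad_char ((-1) ^ m * det B * c) * q ^ m" for c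
    proof -
      have "num_reps B (2 * m + 1) c = reps_value (2 * m + 1) (det B) c"
        using B by (intro num_reps_nonsingular[OF odd]) (auto simp: symm_def)
      then show ?thesis using q by (simp add: reps_value_def q_def)
    qed
    have prod: "quad_char (- det B * c) * quad_char ((-1) ^ m * det B * c) = ?e * nonzero_char c" for c
    proof -
      have eq: "- det B * c * ((-1) ^ m * det B * c) = (det B)\<^sup>2 * (c\<^sup>2 * (-1) ^ (m + 1))"
        by (simp add: power2_eq_square)
      have "quad_char (- det B * c) * quad_char ((-1) ^ m * det B * c) = quad_char (c\<^sup>2 * (-1) ^ (m + 1))"
        unfolding quad_char_mult[OF odd, symmetric] eq by (rule quad_char_mult_square) (use B in simp)
      then show ?thesis
        using quad_char_mult_square[of c "(-1) ^ (m + 1)"] by (cases "c = 0") (simp_all add: nonzero_char_def)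
    qed
    have "(\<Sum>c\<in>UNIV. quad_char (- det B * c) * num_reps B (2 * m + 1) c)
       = (\<Sum>c\<in>UNIV. q ^ (2 * m) * quad_char (- det B * c) + q ^ m * ?e * nonzero_char c)"
    proof (rule sum.cong[OF refl])
      fix c
      have "quad_char (- det B * c) * num_reps B (2 * m + 1) c
        = q ^ (2 * m) * quad_char (- det B * c) + q ^ m * (quad_char (- det B * c) * quad_char ((-1) ^ m * det B * c))"
        unfolding reps by (simp add: algebra_simps)
      then show "quad_char (- det B * c) * num_reps B (2 * m + 1) c
        = q ^ (2 * m) * quad_char (- det B * c) + q ^ m * ?e * nonzero_char c"
        unfolding prod by (simp only: mult.assoc)
    qed
    also have "\<dots> = q ^ (2 * m) * (\<Sum>c\<in>UNIV. quad_char (- det B * c)) + q ^ m * ?e * (\<Sum>c\<in>(UNIV :: 'a set). nonzero_char c)"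
      by (simp only: sum.distrib sum_distrib_left)
    also have "(\<Sum>c\<in>UNIV. quad_char (- det B * c)) = 0"
      using B by (subst sum_mult_reindex) (auto simp: sum_quad_char[OF odd])
    finally show "- (q * (\<Sum>c\<in>UNIV. quad_char (- det B * c) * num_reps B (2 * m + 1) c)) = - (q ^ (m + 1) * (q - 1) * ?e)"
      by (simp add: sum_nonzero_char q_def ac_simps)
  qed
  also have "\<dots> = - (q ^ (m + 1) * (q - 1) * ?e * symm_sum (nonzero_char :: 'a \<Rightarrow> real) (2 * m + 1) k)"
    by (simp add: symm_sum_nonzero_char)
  finally have *: "?e * (symm_sum (quad_char :: 'a \<Rightarrow> real) (2 * m + 2) k - q * symm_sum (quad_char :: 'a \<Rightarrow> real) (2 * m + 2) (k + 1))
    = - (q ^ (m + 1) * (q - 1) * (?e * ?e) * symm_sum (nonzero_char :: 'a \<Rightarrow> real) (2 * m + 1) k)"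
    by simp
  have sq: "?e * ?e = 1" by (rule quad_char_mult_self) simp
  have "Y k - q * Y (k + 1) = ?e * (symm_sum (quad_char :: 'a \<Rightarrow> real) (2 * m + 2) k
      - q * symm_sum (quad_char :: 'a \<Rightarrow> real) (2 * m + 2) (k + 1))"
    by (simp add: Y_def algebra_simps)
  then show ?thesis unfolding * sq by simp
qed

text \<open>In even dimension the nonzero \<open>c\<close> are all represented equally often, so the character cancels.\<close>

lemma signed_odd_recursion:
  assumes odd: "odd CARD('a::{finite,field})" and k: "k \<le> 2 * m"
  shows "symm_sum (quad_char :: 'a \<Rightarrow> real) (2 * m + 1) k
    = real CARD('a) * symm_sum (quad_char :: 'a \<Rightarrow> real) (2 * m + 1) (k + 1)"
proof -
  define q where "q = real CARD('a)"
  have "symm_sum (quad_char :: 'a \<Rightarrow> real) (Suc (2 * m)) k - q * symm_sum (quad_char :: 'a \<Rightarrow> real) (Suc (2 * m)) (Suc k)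
    = (\<Sum>B | B \<in> symm (2 * m) k \<and> det B \<noteq> (0 :: 'a). - (q * (\<Sum>c\<in>UNIV. quad_char (- det B * c) * num_reps B (2 * m) c)))"
    using symm_sum_diag_recursion[OF k, of "quad_char :: 'a \<Rightarrow> real"]
    by (simp only: sum_quad_char[OF odd] q_def mult_zero_right diff_0)
  also have "\<dots> = 0"
  proof (rule sum.neutral, rule ballI)
    fix B :: "'a mat" assume B: "B \<in> {B. B \<in> symm (2 * m) k \<and> det B \<noteq> 0}"
    \<comment> \<open>the number of representations of any nonzero element by the form of \<open>B\<close>\<close>
    define K where "K = q ^ (2 * m) / q - quad_char ((-1) ^ m * det B) * (q ^ m / q)"
    have "quad_char (- det B * c) * num_reps B (2 * m) c = K * quad_char (- det B * c)" for c
    proof -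
      have "num_reps B (2 * m) c = reps_value (2 * m) (det B) c"
        using B by (intro num_reps_nonsingular[OF odd]) (auto simp: symm_def)
      then show ?thesis by (cases "c = 0") (simp_all add: reps_value_def K_def q_def)
    qed
    then have "(\<Sum>c\<in>UNIV. quad_char (- det B * c) * num_reps B (2 * m) c) = K * (\<Sum>c\<in>UNIV. quad_char (- det B * c))"
      by (simp only: sum_distrib_left)
    also have "(\<Sum>c\<in>UNIV. quad_char (- det B * c)) = 0"
      using B by (subst sum_mult_reindex) (auto simp: sum_quad_char[OF odd])
    finally show "- (q * (\<Sum>c\<in>UNIV. quad_char (- det B * c) * num_reps B (2 * m) c)) = 0" by simp
  qed
  finally show ?thesis by (simp add: q_def)
qed

section \<open>Solving the recursions\<close>

lemma zchoose_Suc: "zchoose (Suc K) b = zchoose K b + zchoose K (b - 1)"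
proof (cases "b \<le> 0")
  case True
  then show ?thesis by (cases "b = 0") (auto simp: zchoose_def)
next
  case False
  then obtain i where "b = int (Suc i)" by (metis gr0_conv_Suc not_less zero_less_imp_eq_int)
  then show ?thesis by (simp add: zchoose_def nat_add_distrib)
qed

lemma zchoose_eq_0: "int K < b \<Longrightarrow> zchoose K b = 0"
  by (simp add: zchoose_def)

lemma zchoose_0: "zchoose 0 b = of_bool (b = 0)"
  by (simp add: zchoose_def)

lemma q_dfact_neg: "n \<le> 0 \<Longrightarrow> q_dfact q n = 1"
  unfolding q_dfact_def by (rule prod.neutral) auto

lemma q_dfact_step:
  assumes "n > 0"
  shows "q_dfact q n = q_int q n * q_dfact q (n - 2)"
proof -
  have "{i. 0 < i \<and> i \<le> n \<and> even (n - i)} = insert n {i. 0 < i \<and> i \<le> n - 2 \<and> even (n - 2 - i)}"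
  proof (rule Set.set_eqI, rule iffI)
    fix i assume "i \<in> {i. 0 < i \<and> i \<le> n \<and> even (n - i)}"
    then have i: "0 < i" "i \<le> n" "even (n - i)" by auto
    then have "i \<noteq> n - 1" by auto
    then show "i \<in> insert n {i. 0 < i \<and> i \<le> n - 2 \<and> even (n - 2 - i)}" using i by auto
  qed (use assms in auto)
  moreover have "finite {i. 0 < i \<and> i \<le> n - 2 \<and> even (n - 2 - i)}"
    by (rule finite_subset[of _ "{0..n}"]) auto
  ultimately show ?thesis unfolding q_dfact_def by simp
qed

text \<open>The sums in the closed formulas for sizes \<open>2 m + 1\<close> and \<open>2 m\<close>. The upper limit
  \<open>J\<close> is kept free, since the recursion in \<open>K\<close> shifts it; it does not matter once it is large enough.\<close>

definition odd_size_sum :: "real \<Rightarrow> nat \<Rightarrow> nat \<Rightarrow> nat \<Rightarrow> real" where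
  "odd_size_sum q m K J = (\<Sum>j = 0..J. (-1) ^ j * (q - 1) ^ (m + j) * q_dfact q (2 * int m - 2 * int j + 1) *
     (real (zchoose K (2 * int j - 1)) + (q - 1) * real (zchoose K (2 * int j))))"

definition even_size_sum :: "real \<Rightarrow> nat \<Rightarrow> nat \<Rightarrow> nat \<Rightarrow> real" where
  "even_size_sum q m K J = (\<Sum>j = 0..J. (-1) ^ j * (q - 1) ^ (m + j) * q_dfact q (2 * int m - 2 * int j - 1) *
     (real (zchoose K (2 * int j)) + (q - 1) * real (zchoose K (2 * int j + 1))))"

lemma odd_size_sum_0: "odd_size_sum q m 0 J = (q - 1) ^ (m + 1) * q_dfact q (2 * int m + 1)"
  unfolding odd_size_sum_def
  by (subst sum.mono_neutral_right[of _ "{0}"]) (auto simp: zchoose_0)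

lemma even_size_sum_0: "even_size_sum q m 0 J = (q - 1) ^ m * q_dfact q (2 * int m - 1)"
  unfolding even_size_sum_def
  by (subst sum.mono_neutral_right[of _ "{0}"]) (auto simp: zchoose_0)

text \<open>Pascal's rule, applied to both binomial coefficients, leaves a sum that starts at \<open>j = 1\<close>; shifting the
  index turns it into \<open>even_size_sum\<close>.\<close>

lemma odd_size_sum_Suc: "odd_size_sum q m (Suc K) (Suc J) = odd_size_sum q m K (Suc J) - (q - 1) * even_size_sum q m K J"
proof -
  define t where "t j = (-1) ^ j * (q - 1) ^ (m + j) * q_dfact q (2 * int m - 2 * int j + 1) *
     (real (zchoose K (2 * int j - 2)) + (q - 1) * real (zchoose K (2 * int j - 1)))" for j
  have "odd_size_sum q m (Suc K) (Suc J) = odd_size_sum q m K (Suc J) + (\<Sum>j = 0..Suc J. t j)"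
    unfolding odd_size_sum_def t_def sum.distrib[symmetric]
    by (intro sum.cong refl) (simp add: zchoose_Suc algebra_simps)
  also have "(\<Sum>j = 0..Suc J. t j) = t 0 + (\<Sum>j = 0..J. t (Suc j))"
    using sum.atLeast0_atMost_Suc_shift[of t J] by (simp only: o_def)
  also have "t 0 = 0" by (simp add: t_def zchoose_def)
  also have "(\<Sum>j = 0..J. t (Suc j)) = - ((q - 1) * even_size_sum q m K J)"
    unfolding even_size_sum_def sum_distrib_left sum_negf[symmetric]
    by (intro sum.cong refl) (simp add: t_def algebra_simps)
  finally show ?thesis by simp
qed

text \<open>Again Pascal's rule; this time the remaining sum has the shape of \<open>odd_size_sum\<close> as it stands,
  without an index shift.\<close>

lemma even_size_sum_Suc: "even_size_sum q (Suc m) (Suc K) J = even_size_sum q (Suc m) K J + (q - 1) * odd_size_sum q m K J"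
  unfolding even_size_sum_def odd_size_sum_def sum_distrib_left sum.distrib[symmetric]
  by (intro sum.cong refl) (simp add: zchoose_Suc algebra_simps)

text \<open>With \<open>q ^ K\<close> multiplied in, the recursions for \<open>S\<close> and \<open>Y\<close> in \<open>K\<close> are those that
  \<open>odd_size_sum\<close> and \<open>even_size_sum\<close> satisfy by Pascal's rule. The powers of \<open>q\<close> match because
  \<open>(m\<^sup>2 + m) + (m + 1) = (m + 1)\<^sup>2\<close>.\<close>

lemma solve_recursions:
  fixes q :: real and S Y :: "nat \<Rightarrow> nat \<Rightarrow> real"
  assumes S_rec: "\<And>m k. k \<le> 2 * m \<Longrightarrow> S m k - q * S m (k + 1) = q ^ m * (q - 1) * Y m k"
    and Y_rec: "\<And>m k. k \<le> 2 * m + 1 \<Longrightarrow> Y (Suc m) k - q * Y (Suc m) (k + 1) = - (q ^ (m + 1) * (q - 1) * S m k)"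
    and S_init: "\<And>m. S m 0 = q ^ (m\<^sup>2 + m) * (q - 1) ^ (m + 1) * q_dfact q (2 * int m + 1)"
    and Y_init: "\<And>m. Y m 0 = q ^ m\<^sup>2 * (q - 1) ^ m * q_dfact q (2 * int m - 1)"
  assumes "K \<le> J"
  shows "(K \<le> 2 * m + 1 \<longrightarrow> q ^ K * S m K = q ^ (m\<^sup>2 + m) * odd_size_sum q m K J)
       \<and> (K \<le> 2 * m \<longrightarrow> q ^ K * Y m K = q ^ m\<^sup>2 * even_size_sum q m K J)"
  using \<open>K \<le> J\<close>
proof (induction K arbitrary: m J)
  case 0
  then show ?case by (simp add: odd_size_sum_0 even_size_sum_0 S_init Y_init)
next
  case (Suc K)
  then obtain J' where J: "J = Suc J'" "K \<le> J'" by (cases J) auto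
  have S: "q ^ Suc K * S m (Suc K) = q ^ (m\<^sup>2 + m) * odd_size_sum q m (Suc K) J" if K: "Suc K \<le> 2 * m + 1"
  proof -
    have "q ^ Suc K * S m (Suc K) = q ^ K * (q * S m (K + 1))" by (simp add: ac_simps)
    also have "q * S m (K + 1) = S m K - q ^ m * (q - 1) * Y m K" using S_rec[of K m] K by simp
    also have "q ^ K * (S m K - q ^ m * (q - 1) * Y m K) = q ^ K * S m K - q ^ m * (q - 1) * (q ^ K * Y m K)"
      by (simp add: algebra_simps)
    also have "q ^ K * S m K = q ^ (m\<^sup>2 + m) * odd_size_sum q m K J" using Suc.IH[of J m] Suc.prems K by simp
    also have "q ^ K * Y m K = q ^ m\<^sup>2 * even_size_sum q m K J'" using Suc.IH[of J' m] J K by simp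
    finally show ?thesis by (simp add: J odd_size_sum_Suc power_add algebra_simps)
  qed
  have Y: "q ^ Suc K * Y m (Suc K) = q ^ m\<^sup>2 * even_size_sum q m (Suc K) J" if K: "Suc K \<le> 2 * m"
  proof -
    obtain l where m: "m = Suc l" using K by (cases m) auto
    have "q ^ Suc K * Y m (Suc K) = q ^ K * (q * Y (Suc l) (K + 1))" by (simp add: m ac_simps)
    also have "q * Y (Suc l) (K + 1) = Y m K + q ^ (l + 1) * (q - 1) * S l K" using Y_rec[of K l] K m by simp
    also have "q ^ K * (Y m K + q ^ (l + 1) * (q - 1) * S l K)
        = q ^ K * Y m K + q ^ (l + 1) * (q - 1) * (q ^ K * S l K)"
      by (simp add: algebra_simps)
    also have "q ^ K * S l K = q ^ (l\<^sup>2 + l) * odd_size_sum q l K J" using Suc.IH[of J l] Suc.prems K m by simp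
    also have "q ^ K * Y m K = q ^ m\<^sup>2 * even_size_sum q m K J" using Suc.IH[of J m] Suc.prems K by simp
    also have "q ^ (l + 1) * (q - 1) * (q ^ (l\<^sup>2 + l) * odd_size_sum q l K J)
        = q ^ m\<^sup>2 * ((q - 1) * odd_size_sum q l K J)"
      by (simp add: m power2_eq_square power_add ac_simps)
    finally show ?thesis by (simp add: m even_size_sum_Suc algebra_simps)
  qed
  from S Y show ?case by blast
qed

lemma odd_size_sum_truncate:
  assumes "I \<le> J" "K \<le> 2 * I"
  shows "odd_size_sum q m K I = odd_size_sum q m K J"
  unfolding odd_size_sum_def using assms
  by (intro sum.mono_neutral_left) (auto simp: zchoose_eq_0)

lemma even_size_sum_truncate:
  assumes "I \<le> J" "K \<le> 2 * I + 1"
  shows "even_size_sum q m K I = even_size_sum q m K J"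
  unfolding even_size_sum_def using assms
  by (intro sum.mono_neutral_left) (auto simp: zchoose_eq_0)

text \<open>Here \<open>s\<close>, \<open>e\<close> and \<open>y\<close> stand for the values at \<open>k = 0\<close> of the number of
  invertible symmetric matrices of odd size \<open>2 m + 1\<close>, of even size \<open>2 m\<close>, and of the signed count of size \<open>2 m\<close>. Eliminating \<open>e\<close> and \<open>y\<close>
  gives \<open>s (m + 1) = q ^ (2 * m + 2) * (q ^ (2 * m + 3) - 1) * s m\<close>.\<close>

lemma solve_initial_values:
  fixes q :: real and s y e :: "nat \<Rightarrow> real"
  assumes q: "q > 1"
    and s: "\<And>m. s m = q ^ (2 * m + 1) * e m - q ^ m * y m"
    and e: "e 0 = 1" "\<And>m. e (Suc m) = q ^ (2 * m + 2) * s m"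
    and y: "y 0 = 1" "\<And>m. y (Suc m) = q ^ (m + 1) * s m"
  shows "s m = q ^ (m\<^sup>2 + m) * (q - 1) ^ (m + 1) * q_dfact q (2 * int m + 1)"
    and "y m = q ^ m\<^sup>2 * (q - 1) ^ m * q_dfact q (2 * int m - 1)"
proof -
  have dfact_1: "q_dfact q 1 = 1"
    using q by (simp add: q_dfact_step[of 1] q_dfact_neg q_int_def)
  have s_val: "s m = q ^ (m\<^sup>2 + m) * (q - 1) ^ (m + 1) * q_dfact q (2 * int m + 1)" for m
  proof (induction m)
    case 0
    show ?case by (simp add: s e y dfact_1)
  next
    case (Suc m)
    have "s (Suc m) = q ^ (2 * m + 2) * (q ^ (2 * m + 3) - 1) * s m"
    proof -
      have square: "q ^ (m + 1) * q ^ (m + 1) = q ^ (2 * m + 2)"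
        by (simp only: power_add[symmetric]) (simp add: mult_2)
      have "s (Suc m) = q ^ (2 * m + 3) * (q ^ (2 * m + 2) * s m) - q ^ (m + 1) * (q ^ (m + 1) * s m)"
      proof -
        have "2 * Suc m + 1 = 2 * m + 3" by simp
        then show ?thesis by (simp only: s[of "Suc m"] e(2) y(2)) (simp only: Suc_eq_plus1)
      qed
      also have "q ^ (m + 1) * (q ^ (m + 1) * s m) = q ^ (2 * m + 2) * s m"
        by (simp only: mult.assoc[symmetric] square)
      finally show ?thesis
        by (simp only: left_diff_distrib right_diff_distrib mult_1_right mult.assoc mult.commute mult.left_commute)
    qed
    also have "q ^ (2 * m + 3) - 1 = (q - 1) * q_int q (2 * int m + 3)"
    proof -
      have "q powi (2 * int m + 3) = q ^ (2 * m + 3)"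
        using power_int_of_nat[of q "2 * m + 3"] by simp
      then show ?thesis using q by (simp add: q_int_def)
    qed
    finally have s_Suc: "s (Suc m) = q ^ (2 * m + 2) * ((q - 1) * q_int q (2 * int m + 3)) * s m" .
    have dfact: "q_dfact q (2 * int (Suc m) + 1) = q_int q (2 * int m + 3) * q_dfact q (2 * int m + 1)"
      using q_dfact_step[of "2 * int m + 3" q] by (simp add: algebra_simps)
    have exponent: "(Suc m)\<^sup>2 + Suc m = (m\<^sup>2 + m) + (2 * m + 2)" by (simp add: power2_eq_square)
    have power: "(q - 1) ^ (Suc m + 1) = (q - 1) * (q - 1) ^ (m + 1)" by simp
    show ?case
      unfolding s_Suc Suc.IH dfact exponent power power_add[of q "m\<^sup>2 + m"]
      by (simp only: mult.assoc mult.commute mult.left_commute)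
  qed
  then show "s m = q ^ (m\<^sup>2 + m) * (q - 1) ^ (m + 1) * q_dfact q (2 * int m + 1)" .
  show "y m = q ^ m\<^sup>2 * (q - 1) ^ m * q_dfact q (2 * int m - 1)"
  proof (cases m)
    case 0
    then show ?thesis by (simp add: y q_dfact_neg)
  next
    case (Suc l)
    have exponent: "(Suc l)\<^sup>2 = (l\<^sup>2 + l) + (l + 1)" by (simp add: power2_eq_square)
    have "2 * int (Suc l) - 1 = 2 * int l + 1" by simp
    then show ?thesis
      unfolding Suc y(2) s_val exponent power_add[of q "l\<^sup>2 + l"]
      by (simp only: Suc_eq_plus1 mult.assoc mult.commute mult.left_commute)
  qed
qed

lemma geometric_recursion:
  fixes s :: "nat \<Rightarrow> real"
  assumes "\<And>k. k < n \<Longrightarrow> s k = q * s (k + 1)" "q > 0" "k \<le> n"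
  shows "s k = s 0 / q ^ k"
  using assms(3)
proof (induction k)
  case (Suc k)
  then show ?case using assms(1)[of k] assms(2) by (simp add: field_simps)
qed simp

section \<open>Invertible symmetric matrices with zeros on the diagonal\<close>

lemma invertible_mat_iff_det:
  fixes A :: "'a::field mat"
  assumes A: "A \<in> carrier_mat n n"
  shows "invertible_mat A \<longleftrightarrow> det A \<noteq> 0"
proof
  assume "invertible_mat A"
  then obtain B where B: "A * B = 1\<^sub>m n" "B * A = 1\<^sub>m (dim_row B)"
    using A by (auto simp: invertible_mat_def inverts_mat_def)
  have "B \<in> carrier_mat n n"
    using arg_cong[OF B(1), of dim_col] arg_cong[OF B(2), of dim_col] A by auto
  then have "det A * det B = 1" using det_mult[OF A, of B] B(1) by simp
  then show "det A \<noteq> 0" by auto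
next
  assume "det A \<noteq> 0"
  from det_non_zero_imp_unit[OF A this, of "()"]
  obtain B where "B \<in> carrier_mat n n" "A * B = 1\<^sub>m n" "B * A = 1\<^sub>m n"
    by (auto simp: Units_def ring_mat_def)
  then show "invertible_mat A" using A by (auto simp: invertible_mat_def inverts_mat_def)
qed

lemma sz_mats_symm: "sz_mats n k = {A \<in> symm n k. det A \<noteq> 0}"
  by (auto simp: sz_mats_def sym_mats_def symm_def invertible_mat_iff_det)

lemma num_sz_symm_sum: "real (num_sz TYPE('a::{finite,field}) n k) = symm_sum (nonzero_char :: 'a \<Rightarrow> real) n k"
  by (simp add: num_sz_def sz_mats_symm symm_sum_nonzero_char)

lemma num_sym_symm_sum: "real (num_sym TYPE('a::{finite,field}) n) = symm_sum (nonzero_char :: 'a \<Rightarrow> real) n 0"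
  using num_sz_symm_sum[where 'a = 'a, of n 0] by (simp add: num_sym_def num_sz_def sz_mats_def)

text \<open>On nonzero elements the sum of the two characters is twice the indicator of the squares.\<close>

lemma num_sz_plus_symm_sum:
  "real (num_sz_plus TYPE('a::{finite,field}) n k)
    = (symm_sum (nonzero_char :: 'a \<Rightarrow> real) n k + symm_sum (quad_char :: 'a \<Rightarrow> real) n k) / 2"
proof -
  have "nonzero_char d + quad_char d = 2 * of_bool (d \<noteq> 0 \<and> is_square d)" for d :: 'a
    by (simp add: nonzero_char_def quad_char_def)
  then have "symm_sum (nonzero_char :: 'a \<Rightarrow> real) n k + symm_sum (quad_char :: 'a \<Rightarrow> real) n k
      = 2 * (\<Sum>A\<in>symm n k. of_bool (det A \<noteq> (0 :: 'a) \<and> is_square (det A)))"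
    unfolding symm_sum_def sum.distrib[symmetric] by (simp only: sum_distrib_left)
  also have "(\<Sum>A\<in>symm n k. of_bool (det A \<noteq> (0 :: 'a) \<and> is_square (det A)))
      = real (num_sz_plus TYPE('a) n k)"
    unfolding num_sz_plus_def sz_plus_mats_def sz_mats_symm
    by (subst sum_of_bool_eq) (auto intro!: arg_cong[where f = card])
  finally show ?thesis by simp
qed

theorem theorem4p25:
  fixes q m :: nat
  assumes "CARD('a::{finite,field}) = q" and "odd q" and "m \<ge> 1"
  shows
    "(\<forall>k \<le> 2 * m - 1.
        real (num_sz TYPE('a) (2 * m) (k + 1)) = 1 / real q ^ (k + 1) * real (num_sym TYPE('a) (2 * m)))
   \<and> (\<forall>k \<le> 2 * m.
        real (num_sz TYPE('a) (2 * m + 1) (k + 1)) =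
          real q ^ (m\<^sup>2 + m) / real q ^ (k + 1) *
          (\<Sum>j = 0..k div 2 + 1.
             (-1) ^ j * (real q - 1) ^ (m + j) * q_dfact (real q) (2 * int m - 2 * int j + 1) *
             (real (zchoose (k + 1) (2 * int j - 1))
              + (real q - 1) * real (zchoose (k + 1) (2 * int j)))))
   \<and> (\<forall>k \<le> 2 * m - 1.
        real (num_sz_plus TYPE('a) (2 * m) (k + 1)) =
          real (num_sym TYPE('a) (2 * m)) / (2 * real q ^ (k + 1)) +
          (-1) ^ (if is_square ((-1 :: 'a) ^ m) then 0 else 1 :: nat) * real q ^ (m\<^sup>2)
            / (2 * real q ^ (k + 1)) *
          (\<Sum>j = 0..nat \<lceil>real k / 2\<rceil>.
             (-1) ^ j * (real q - 1) ^ (m + j) * q_dfact (real q) (2 * int m - 2 * int j - 1) *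
             (real (zchoose (k + 1) (2 * int j))
              + (real q - 1) * real (zchoose (k + 1) (2 * int j + 1)))))
   \<and> (\<forall>k \<le> 2 * m.
        real (num_sz_plus TYPE('a) (2 * m + 1) (k + 1)) =
          1 / 2 * real (num_sz TYPE('a) (2 * m + 1) (k + 1)))"
proof -
  have odd: "odd CARD('a)" using assms by simp
  define Q where "Q = real q"
  have Q: "Q > 1" and card: "real CARD('a) = Q"
    using card_field_gt_1[where 'a = 'a] assms(1) by (simp_all add: Q_def)
  define N :: "nat \<Rightarrow> nat \<Rightarrow> real" where "N = symm_sum (nonzero_char :: 'a \<Rightarrow> real)"
  define X :: "nat \<Rightarrow> nat \<Rightarrow> real" where "X = symm_sum (quad_char :: 'a \<Rightarrow> real)"
  define e where "e m = quad_char ((-1) ^ m :: 'a)" for m :: nat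
  define S where "S m = N (2 * m + 1)" for m
  define Y where "Y m k = e m * X (2 * m) k" for m k
  have e_sq: "e m * e m = 1" for m unfolding e_def by (rule quad_char_mult_self) simp

  have N_even: "N (2 * m) k = Q * N (2 * m) (k + 1)" if "k < 2 * m" for m k
  proof -
    from that obtain l where "m = Suc l" by (cases m) auto
    then show ?thesis using count_even_recursion[OF odd, of k l] that by (simp add: N_def card)
  qed
  have X_odd: "X (2 * m + 1) k = Q * X (2 * m + 1) (k + 1)" if "k \<le> 2 * m" for m k
    using signed_odd_recursion[OF odd that] by (simp add: X_def card)
  have S_rec: "S m k - Q * S m (k + 1) = Q ^ m * (Q - 1) * Y m k" if "k \<le> 2 * m" for m k
    using count_odd_recursion[OF odd that] by (simp add: S_def N_def Y_def X_def e_def card)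
  have Y_rec: "Y (Suc m) k - Q * Y (Suc m) (k + 1) = - (Q ^ (m + 1) * (Q - 1) * S m k)" if "k \<le> 2 * m + 1" for m k
    using signed_even_recursion[OF odd that] by (simp add: S_def N_def Y_def X_def e_def card)

  have N_pivot: "N (Suc n) 0 = Q ^ n * (Q - 1) * N n 0 + N (Suc n) 1" for n
    unfolding N_def card[symmetric] sum_nonzero_char[where 'a = 'a, symmetric]
    by (rule symm_sum_pivot_recursion) (auto simp: nonzero_char_def)
  have X_pivot: "X (Suc n) 0 = X (Suc n) 1" for n
    using symm_sum_pivot_recursion[of "quad_char :: 'a \<Rightarrow> real" n]
    by (simp add: X_def sum_quad_char[OF odd] quad_char_mult[OF odd])

  have N_0: "N 0 0 = 1" and X_0: "X 0 0 = 1"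
    by (simp_all add: N_def X_def symm_sum_0 nonzero_char_def)
  \<comment> \<open>In each of the next three steps the term with \<open>k = 1\<close> is eliminated between
    the pivot recursion and the diagonal recursion.\<close>
  have init_S: "S m 0 = Q ^ (2 * m + 1) * N (2 * m) 0 - Q ^ m * Y m 0" for m
  proof -
    have "(Q - 1) * S m 0 = (Q - 1) * (Q ^ (2 * m + 1) * N (2 * m) 0 - Q ^ m * Y m 0)"
      using arg_cong[OF N_pivot[of "2 * m"], of "(*) Q"] S_rec[of 0 m] by (simp add: S_def algebra_simps)
    then show ?thesis using Q by simp
  qed
  have init_N: "N (2 * Suc m) 0 = Q ^ (2 * m + 2) * S m 0" for m
  proof -
    have "(Q - 1) * N (2 * Suc m) 0 = (Q - 1) * (Q ^ (2 * m + 2) * S m 0)"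
      using arg_cong[OF N_pivot[of "2 * m + 1"], of "(*) Q"] N_even[of 0 "Suc m"] by (simp add: S_def algebra_simps)
    then show ?thesis using Q by simp
  qed
  have init_Y: "Y (Suc m) 0 = Q ^ (m + 1) * S m 0" for m
  proof -
    have "(Q - 1) * Y (Suc m) 0 = (Q - 1) * (Q ^ (m + 1) * S m 0)"
      using X_pivot[of "2 * m + 1"] Y_rec[of 0 m] by (simp add: Y_def algebra_simps)
    then show ?thesis using Q by simp
  qed
  have Y_0: "Y 0 0 = 1" by (simp add: Y_def X_0 e_def)
  note init = solve_initial_values[of Q "\<lambda>m. S m 0" "\<lambda>m. N (2 * m) 0" "\<lambda>m. Y m 0",
      OF Q init_S _ init_N Y_0 init_Y]
  have S_init: "S m 0 = Q ^ (m\<^sup>2 + m) * (Q - 1) ^ (m + 1) * q_dfact Q (2 * int m + 1)" for m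
    by (rule init(1)) (simp add: N_0)
  have Y_init: "Y m 0 = Q ^ m\<^sup>2 * (Q - 1) ^ m * q_dfact Q (2 * int m - 1)" for m
    by (rule init(2)) (simp add: N_0)
  note closed = solve_recursions[of S Q Y, OF S_rec Y_rec S_init Y_init]

  have X_odd_0: "X (2 * m + 1) k = 0" if "k \<le> 2 * m + 1" for m k
  proof -
    have "(Q - 1) * X (2 * m + 1) 0 = 0"
      using X_pivot[of "2 * m"] X_odd[of 0 m] by (simp add: algebra_simps)
    then have "X (2 * m + 1) 0 = 0" using Q by simp
    then show ?thesis
      using geometric_recursion[of "2 * m + 1" "X (2 * m + 1)" Q k] X_odd Q that by simp
  qed
  have num_sz: "real (num_sz TYPE('a) n k) = N n k"
    and num_sym: "real (num_sym TYPE('a) n) = N n 0"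
    and num_sz_plus: "real (num_sz_plus TYPE('a) n k) = (N n k + X n k) / 2" for n k
    by (simp_all add: num_sz_symm_sum num_sym_symm_sum num_sz_plus_symm_sum N_def X_def)

  have even_count: "N (2 * m) (k + 1) = N (2 * m) 0 / Q ^ (k + 1)" if "k \<le> 2 * m - 1" for k
    using geometric_recursion[of "2 * m" "N (2 * m)" Q "k + 1"] N_even Q that \<open>m \<ge> 1\<close> by simp
  have odd_count: "N (2 * m + 1) (k + 1) = Q ^ (m\<^sup>2 + m) / Q ^ (k + 1) * odd_size_sum Q m (k + 1) (k div 2 + 1)"
    if "k \<le> 2 * m" for k
  proof -
    have "odd_size_sum Q m (k + 1) (k div 2 + 1) = odd_size_sum Q m (k + 1) (k + 1)"
      by (rule odd_size_sum_truncate) auto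
    moreover have "Q ^ (k + 1) * S m (k + 1) = Q ^ (m\<^sup>2 + m) * odd_size_sum Q m (k + 1) (k + 1)"
      using closed[of "k + 1" "k + 1" m] that by simp
    ultimately show ?thesis using Q by (simp add: S_def field_simps)
  qed
  have sign: "(-1) ^ (if is_square ((-1 :: 'a) ^ m) then 0 else 1 :: nat) = e m"
    by (simp add: e_def quad_char_def)
  have even_signed: "X (2 * m) (k + 1) = e m * Q ^ m\<^sup>2 / Q ^ (k + 1) * even_size_sum Q m (k + 1) (nat \<lceil>real k / 2\<rceil>)"
    if "k \<le> 2 * m - 1" for k
  proof -
    have "nat \<lceil>real k / 2\<rceil> = (k + 1) div 2" by linarith
    then have "even_size_sum Q m (k + 1) (nat \<lceil>real k / 2\<rceil>) = even_size_sum Q m (k + 1) (k + 1)"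
      by (intro even_size_sum_truncate) auto
    moreover have "Q ^ (k + 1) * Y m (k + 1) = Q ^ m\<^sup>2 * even_size_sum Q m (k + 1) (k + 1)"
      using closed[of "k + 1" "k + 1" m] that \<open>m \<ge> 1\<close> by simp
    moreover have "X (2 * m) (k + 1) = e m * Y m (k + 1)"
      using e_sq[of m] by (simp add: Y_def mult.assoc[symmetric])
    ultimately show ?thesis using Q by (simp add: field_simps)
  qed
  show ?thesis
    unfolding num_sz num_sym num_sz_plus sign Q_def[symmetric] odd_size_sum_def[symmetric] even_size_sum_def[symmetric]
    using even_count odd_count even_signed X_odd_0 by (simp add: field_simps)
qed

end
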